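(* Let $\mathcal A\in\mathbb R^{m\times n\times p}$, $\mathcal B\in\mathbb R^{m\times 1\times p}$, let $\mathcal K$ be a real third order tensor of size $q\times n\times p$, and let $\delta$ be the given bound. Consider the tensor regularized total least squares (TR-TLS) problem $$\min_{\tilde{\mathcal A},\tilde{\mathcal B},\mathcal X}\left\|(\mathcal A,\mathcal B)-(\tilde{\mathcal A},\tilde{\mathcal A}*\mathcal X)\right\|_F\quad\text{s.t.}\quad \tilde{\mathcal B}=\tilde{\mathcal A}*\mathcal X,\quad \|\mathcal K*\mathcal X\|_F\le\delta.$$ If the constraint $\|\mathcal K*\mathcal X\|_F\le\delta$ is active, then the solution $\mathcal X^*\in\mathbb R^{n\times1\times p}$ of the TR-TLS problem satisfies $$\Gamma(\mathcal X^* )\begin{pmatrix}\mathrm{unfold}(\mathcal X^* )\\-\mathrm{unfold}(\mathcal I_{11p})\end{pmatrix}=-\Lambda\begin{pmatrix}\mathrm{unfold}(\mathcal X^* )\\-\mathrm{unfold}(\mathcal I_{11p})\end{pmatrix},$$ where $$\Gamma(\mathcal X^* )=\begin{pmatrix}M&N\\N^\top&P\end{pmatrix},\qquad \Lambda=\begin{pmatrix}\Lambda_1&0\\0&\Lambda_2\end{pmatrix},$$ $$M=\mathrm{bcirc}\big(\mathcal A^\top*\mathcal A+\mathcal K^\top*\mathcal K*(\widetilde{\lambda_K}\otimes\mathcal I_{nnp})\big),\qquad N=\mathrm{bcirc}(\mathcal A^\top*\mathcal B),$$ $$P=\mathrm{bcirc}\big(-\widetilde{\lambda_K}*(\mathcal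 X^* )^\top*\mathcal K^\top*\mathcal K*\mathcal X^*+\mathcal B^\top*\mathcal B\big),\qquad \Lambda_1=\mathrm{bcirc}(\widetilde{\lambda_I}\otimes\mathcal I_{nnp}),\qquad \Lambda_2=\mathrm{bcirc}(\widetilde{\lambda_I}),$$ and the tubes $\widetilde{\lambda_I},\widetilde{\lambda_K}\in\mathbb R^{1\times1\times p}$ are $$\widetilde{\lambda_I}=\mu\,(\mathcal X^* )^\top*\mathcal K^\top*\mathcal K*\mathcal X^*-\mathbf R^\top*\mathbf R*(\mathcal X^* )^\top*\mathcal X^*-\mathbf R^\top*\mathcal B,\qquad \widetilde{\lambda_K}=\mu(\mathcal I_{11p}+(\mathcal X^* )^\top*\mathcal X^* ),$$ with $\mu\in\mathbb R$ the Lagrange multiplier corresponding to the solution and $\mathbf R=\mathcal B-\tilde{\mathcal A}*\mathcal X^*$, where $\tilde{\mathcal A}$ is the $\tilde{\mathcal A}$-component of the solution.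
   Context: Notation. For $\mathcal A\in\mathbb R^{m\times n\times p}$ let $A^{(i)}\in\mathbb R^{m\times n}$ ($i=1,\dots,p$) be its frontal slices $\mathcal A[:,:,i]$. $\mathrm{bcirc}(\mathcal A)\in\mathbb R^{mp\times np}$ is the block circulant matrix whose first block column is $A^{(1)},A^{(2)},\dots,A^{(p)}$, i.e. whose $(i,j)$ block is $A^{(((i-j)\bmod p)+1)}$. It is block-diagonalized as $\mathrm{bcirc}(\mathcal A)=(F_p^{\rm H}\otimes I_m)\,\mathrm{diag}(A_1,\dots,A_p)\,(F_p\otimes I_n)$ with $A_i\in\mathbb C^{m\times n}$, where $F_p=\frac1{\sqrt p}(\omega^{(i-1)(j-1)})_{i,j=1}^p$, $\omega=e^{-2\pi \mathbf i/p}$. $\mathrm{unfold}(\mathcal B)$ stacks the frontal slices $B^{(1)},\dots,B^{(p)}$ vertically, and $\mathrm{fold}$ is its inverse. The T-product of $\mathcal A\in\mathbb R^{m\times n\times p}$ and $\mathcal B\in\mathbb R^{n\times s\times p}$ is $\mathcal A*\mathcal B=\mathrm{fold}(\mathrm{bcirc}(\mathcal A)\,\mathrm{unfold}(\mathcal B))\in\mathbb R^{m\times s\times p}$. The transpose $\mathcal A^\top\in\mathbb R^{n\times m\times p}$ has frontal slices $\mathcal A^\top[:,:,1]=\mathcal A[:,:,1]^\top$ and $\mathcal A^\top[:,:,i]=\mathcal A[:,:,p+2-i]^\top$ for $i=2,\dots,p$. The identity tensor $\mathcal I_{nnp}\in\mathbb R^{n\times n\times p}$ has first frontal slice $I_n$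 and all other frontal slices zero ($\mathcal I_{11p}$ is the case $n=1$). The Kronecker product (based on the T-product) of $\mathcal A\in\mathbb R^{m\times n\times p}$ and $\mathcal B\in\mathbb R^{t\times s\times p}$, with diagonal blocks $A_i\in\mathbb C^{m\times n}$, $B_i\in\mathbb C^{t\times s}$ in the block diagonalizations $\mathrm{bcirc}(\mathcal A)=(F_p^{\rm H}\otimes I_m)\,\mathrm{diag}(A_1,\dots,A_p)\,(F_p\otimes I_n)$ and $\mathrm{bcirc}(\mathcal B)=(F_p^{\rm H}\otimes I_t)\,\mathrm{diag}(B_1,\dots,B_p)\,(F_p\otimes I_s)$, is $\mathcal A\otimes\mathcal B=\mathrm{bcirc}^{-1}\big((F_p^{\rm H}\otimes I_{mt})\,\mathrm{diag}(A_1\otimes B_1,\dots,A_p\otimes B_p)\,(F_p\otimes I_{ns})\big)\in\mathbb R^{mt\times ns\times p}$. The Frobenius norm is $\|\mathcal X\|_F=\sqrt{\sum_{i,j,k}x_{ijk}^2}$. $(\mathcal A,\mathcal B)$ denotes concatenation along the second mode. A tube is an element of $\mathbb R^{1\times1\times p}$. The constraint is active if it holds with equality at the solution, $\|\mathcal K*\mathcal X^*\|_F=\delta$. Lagrange multiplier: the Lagrangian of the TR-TLS problem is $\hat{\mathcal L}(\tilde{\mathcal A},\mathcal X,\mu)=\|(\mathcal A,\mathcal B)-(\tilde{\mathcal A},\tilde{\mathcal A}*\mathcal X)\|_F^2+\mu(\|\mathcal K*\mathcal X\|_F^2-\delta^2)$; $\mu$ being the corresponding Lagrange multiplier means that the partial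 derivatives of $\hat{\mathcal L}$ with respect to $\tilde{\mathcal A}$ and $\mathcal X$ vanish at the solution $(\tilde{\mathcal A},\mathcal X^* )$ with this $\mu$. *)

theory Defs
  imports
    "HOL-Analysis.Derivative"
    "Jordan_Normal_Form.Matrix"
    "Jordan_Normal_Form.Schur_Decomposition"
begin

section \<open>Third order tensors and the T-product\<close>

text \<open>A tensor is the list of its frontal slices; slices, rows and columns are indexed from 0,
  so the slice with index \<open>k\<close> here is the slice \<open>k + 1\<close> of the usual 1-based notation.
  The operations below read the slice format off the slice 0 and are meant for elements of
  \<open>tensor_space m n p\<close> with \<open>p > 0\<close>.\<close>

type_synonym tensor = "real mat list"

definition tensor_space :: "nat \<Rightarrow> nat \<Rightarrow> nat \<Rightarrow> tensor set" where
  "tensor_space m n p = {A. length A = p \<and> set A \<subseteq> carrier_mat m n}"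

definition t_rows :: "tensor \<Rightarrow> nat" where
  "t_rows A = dim_row (A ! 0)"

definition t_cols :: "tensor \<Rightarrow> nat" where
  "t_cols A = dim_col (A ! 0)"

text \<open>Block \<open>(I, J)\<close> of the block circulant matrix is the slice \<open>(I - J) mod p\<close>; adding \<open>p\<close>
  keeps the subtraction of natural numbers from truncating.\<close>

definition bcirc :: "tensor \<Rightarrow> real mat" where
  "bcirc A = (let m = t_rows A; n = t_cols A; p = length A in
     mat (m * p) (n * p)
       (\<lambda>(i, j). (A ! ((i div m + p - j div n) mod p)) $$ (i mod m, j mod n)))"

definition unfold :: "tensor \<Rightarrow> real mat" where
  "unfold A = (let m = t_rows A; p = length A in
     mat (m * p) (t_cols A) (\<lambda>(i, j). (A ! (i div m)) $$ (i mod m, j)))"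

text \<open>The inverse of \<open>unfold\<close> for tensors with \<open>p\<close> slices.\<close>

definition fold_tensor :: "nat \<Rightarrow> real mat \<Rightarrow> tensor" where
  "fold_tensor p M = (let m = dim_row M div p in
     map (\<lambda>k. mat m (dim_col M) (\<lambda>(i, j). M $$ (k * m + i, j))) [0..<p])"

definition tprod :: "tensor \<Rightarrow> tensor \<Rightarrow> tensor" (infixl \<open>\<star>\<close> 70) where
  "A \<star> B = fold_tensor (length A) (bcirc A * unfold B)"

definition ttranspose :: "tensor \<Rightarrow> tensor" (\<open>(_\<^sup>\<top>)\<close> [1000] 999) where
  "A\<^sup>\<top> = map (\<lambda>k. transpose_mat (A ! (if k = 0 then 0 else length A - k))) [0..<length A]"

definition tid :: "nat \<Rightarrow> nat \<Rightarrow> tensor" where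
  "tid n p = map (\<lambda>k. if k = 0 then 1\<^sub>m n else 0\<^sub>m n n) [0..<p]"

definition tadd :: "tensor \<Rightarrow> tensor \<Rightarrow> tensor" (infixl \<open>\<oplus>\<^sub>t\<close> 65) where
  "A \<oplus>\<^sub>t B = map2 (+) A B"

definition tminus :: "tensor \<Rightarrow> tensor \<Rightarrow> tensor" (infixl \<open>\<ominus>\<^sub>t\<close> 65) where
  "A \<ominus>\<^sub>t B = map2 (-) A B"

definition tuminus :: "tensor \<Rightarrow> tensor" where
  "tuminus A = map uminus A"

definition tsmult :: "real \<Rightarrow> tensor \<Rightarrow> tensor" (infixr \<open>\<cdot>\<^sub>t\<close> 70) where
  "c \<cdot>\<^sub>t A = map (\<lambda>M. c \<cdot>\<^sub>m M) A"

text \<open>Concatenation along the second mode.\<close>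

definition tconcat :: "tensor \<Rightarrow> tensor \<Rightarrow> tensor" where
  "tconcat A B =
     map2 (\<lambda>M N. four_block_mat M N (0\<^sub>m 0 (dim_col M)) (0\<^sub>m 0 (dim_col N))) A B"

definition tnorm :: "tensor \<Rightarrow> real" where
  "tnorm A = sqrt (\<Sum>k<length A. \<Sum>i<t_rows A. \<Sum>j<t_cols A. ((A ! k) $$ (i, j))\<^sup>2)"

section \<open>The Kronecker product based on the T-product\<close>

definition kron :: "'a::times mat \<Rightarrow> 'a mat \<Rightarrow> 'a mat" where
  "kron A B = mat (dim_row A * dim_row B) (dim_col A * dim_col B)
     (\<lambda>(i, j). A $$ (i div dim_row B, j div dim_col B) * B $$ (i mod dim_row B, j mod dim_col B))"

definition fourier_mat :: "nat \<Rightarrow> complex mat" where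
  "fourier_mat p =
     mat p p (\<lambda>(i, j). exp (- (2 * of_real pi * \<i> / of_nat p)) ^ (i * j) / of_real (sqrt (of_nat p)))"

definition fourier_block_diag :: "nat \<Rightarrow> nat \<Rightarrow> complex mat list \<Rightarrow> complex mat" where
  "fourier_block_diag m n Ds =
     kron (mat_adjoint (fourier_mat (length Ds))) (1\<^sub>m m) * diag_block_mat Ds *
       kron (fourier_mat (length Ds)) (1\<^sub>m n)"

text \<open>The blocks \<open>A\<^sub>1, \<dots>, A\<^sub>p\<close> of the block diagonalization of \<open>bcirc A\<close>.\<close>

definition fourier_blocks :: "tensor \<Rightarrow> complex mat list" where
  "fourier_blocks A = (let m = t_rows A; n = t_cols A in
     THE Ds. length Ds = length A \<and> set Ds \<subseteq> carrier_mat m n \<and>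
       map_mat complex_of_real (bcirc A) = fourier_block_diag m n Ds)"

definition bcirc_inv :: "nat \<Rightarrow> nat \<Rightarrow> nat \<Rightarrow> complex mat \<Rightarrow> tensor" where
  "bcirc_inv m n p M =
     (THE C. C \<in> tensor_space m n p \<and> map_mat complex_of_real (bcirc C) = M)"

definition tkron :: "tensor \<Rightarrow> tensor \<Rightarrow> tensor" (infixl \<open>\<otimes>\<^sub>t\<close> 75) where
  "A \<otimes>\<^sub>t B = (let r = t_rows A * t_rows B; s = t_cols A * t_cols B in
     bcirc_inv r s (length A)
       (fourier_block_diag r s (map2 kron (fourier_blocks A) (fourier_blocks B))))"

section \<open>Tensor regularized total least squares\<close>

definition trtls_feasible ::
    "nat \<Rightarrow> nat \<Rightarrow> nat \<Rightarrow> tensor \<Rightarrow> real \<Rightarrow> tensor \<Rightarrow> tensor \<Rightarrow> tensor \<Rightarrow> bool" where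
  "trtls_feasible m n p K \<delta> At Bt X \<longleftrightarrow>
     At \<in> tensor_space m n p \<and> Bt \<in> tensor_space m 1 p \<and> X \<in> tensor_space n 1 p \<and>
     Bt = At \<star> X \<and> tnorm (K \<star> X) \<le> \<delta>"

definition trtls_objective :: "tensor \<Rightarrow> tensor \<Rightarrow> tensor \<Rightarrow> tensor \<Rightarrow> real" where
  "trtls_objective A B At X = tnorm (tconcat A B \<ominus>\<^sub>t tconcat At (At \<star> X))"

definition trtls_solution ::
    "nat \<Rightarrow> nat \<Rightarrow> nat \<Rightarrow> tensor \<Rightarrow> tensor \<Rightarrow> tensor \<Rightarrow> real \<Rightarrow>
      tensor \<Rightarrow> tensor \<Rightarrow> tensor \<Rightarrow> bool" where
  "trtls_solution m n p A B K \<delta> At Bt X \<longleftrightarrow>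
     trtls_feasible m n p K \<delta> At Bt X \<and>
     (\<forall>At' Bt' X'. trtls_feasible m n p K \<delta> At' Bt' X' \<longrightarrow>
        trtls_objective A B At X \<le> trtls_objective A B At' X')"

definition trtls_lagrangian ::
    "tensor \<Rightarrow> tensor \<Rightarrow> tensor \<Rightarrow> real \<Rightarrow> tensor \<Rightarrow> tensor \<Rightarrow> real \<Rightarrow> real" where
  "trtls_lagrangian A B K \<delta> At X \<mu> =
     (tnorm (tconcat A B \<ominus>\<^sub>t tconcat At (At \<star> X)))\<^sup>2 + \<mu> * ((tnorm (K \<star> X))\<^sup>2 - \<delta>\<^sup>2)"

definition tupdate :: "tensor \<Rightarrow> nat \<Rightarrow> nat \<Rightarrow> nat \<Rightarrow> real \<Rightarrow> tensor" where
  "tupdate T i j k x =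
     T[k := mat (dim_row (T ! k)) (dim_col (T ! k))
              (\<lambda>(a, b). if a = i \<and> b = j then x else (T ! k) $$ (a, b))]"

text \<open>All partial derivatives of \<open>f\<close> with respect to the entries of its tensor argument
  exist and vanish at \<open>T\<close>.\<close>

definition tensor_gradient_zero :: "(tensor \<Rightarrow> real) \<Rightarrow> tensor \<Rightarrow> bool" where
  "tensor_gradient_zero f T \<longleftrightarrow>
     (\<forall>i<t_rows T. \<forall>j<t_cols T. \<forall>k<length T.
        ((\<lambda>x. f (tupdate T i j k x)) has_real_derivative 0) (at ((T ! k) $$ (i, j))))"

definition trtls_multiplier ::
    "tensor \<Rightarrow> tensor \<Rightarrow> tensor \<Rightarrow> real \<Rightarrow> tensor \<Rightarrow> tensor \<Rightarrow> real \<Rightarrow> bool" where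
  "trtls_multiplier A B K \<delta> At X \<mu> \<longleftrightarrow>
     tensor_gradient_zero (\<lambda>T. trtls_lagrangian A B K \<delta> T X \<mu>) At \<and>
     tensor_gradient_zero (\<lambda>Y. trtls_lagrangian A B K \<delta> At Y \<mu>) X"

end

theory Submission
  imports Defs
begin

text \<open>Block circulant matrices turn the T-product into the matrix product, so tensors compose like
  matrices, and tubes commute. The partial derivatives of the Lagrangian vanish exactly when
  \<open>At = A + R * X\<^sup>\<top>\<close> and \<open>At\<^sup>\<top> * R = \<mu> (K\<^sup>\<top> * K * X)\<close>. With the tube \<open>W = I + X\<^sup>\<top> * X\<close>
  the first condition reads \<open>A * X - B = - R * W\<close>, and both together give
  \<open>A\<^sup>\<top> * R = \<mu> (K\<^sup>\<top> * K * X) - X * R\<^sup>\<top> * R\<close> and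
  \<open>B\<^sup>\<top> * R = \<mu> (X\<^sup>\<top> * K\<^sup>\<top> * K * X) + R\<^sup>\<top> * R\<close>. The last tube is symmetric, so
  \<open>R\<^sup>\<top> * B = B\<^sup>\<top> * R\<close> and \<open>lamI\<close> collapses to \<open>- R\<^sup>\<top> * R * W\<close>; the two block rows are then
  \<open>A\<^sup>\<top> * (A * X - B)\<close> and \<open>B\<^sup>\<top> * (A * X - B)\<close> with the \<open>\<mu>\<close>-terms cancelled by \<open>lamK\<close>.
  The Kronecker product of a tube with the identity tensor has the multiples of the identity matrix
  by the entries of the tube as slices, because the discrete Fourier transform acts entrywise.\<close>

subsection \<open>Index arithmetic\<close>

text \<open>Slices of a block circulant matrix are indexed by cyclic differences; this case split
  lets linear arithmetic settle the identities between such indices.\<close>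

lemma mod_diff_eq:
  fixes k l p :: nat
  assumes "k < p" "l < p"
  shows "(k + p - l) mod p = (if l \<le> k then k - l else k + p - l)"
  using assms by (auto simp: mod_if)

text \<open>Subtracting \<open>c\<close> modulo \<open>p\<close> permutes the indices below
  \<open>p\<close>; the witness \<open>i\<close> is the inverse permutation, adding \<open>c\<close>
  with wrap-around.\<close>

lemma sum_mod_shift:
  fixes f :: "nat \<Rightarrow> 'a::comm_monoid_add"
  assumes "c < p"
  shows "(\<Sum>l<p. f ((l + p - c) mod p)) = (\<Sum>l<p. f l)"
proof (rule sum.reindex_bij_witness[where i = "\<lambda>l. if l + c < p then l + c else l + c - p" and j = "\<lambda>l. (l + p - c) mod p"])
qed (use assms in \<open>auto simp: mod_diff_eq\<close>)

text \<open>The reflection of \<open>l\<close> to \<open>k - l\<close> modulo \<open>p\<close> is an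
  involution, so the same map serves as both witnesses. This is the commutativity of cyclic
  convolution; with \<open>k = 0\<close> it also undoes the reversal of slices in a
  transpose.\<close>

lemma sum_mod_reflect:
  fixes f :: "nat \<Rightarrow> nat \<Rightarrow> 'a::comm_monoid_add"
  assumes "k < p"
  shows "(\<Sum>l<p. f ((k + p - l) mod p) l) = (\<Sum>l<p. f l ((k + p - l) mod p))"
proof (rule sum.reindex_bij_witness[where i = "\<lambda>l. (k + p - l) mod p" and j = "\<lambda>l. (k + p - l) mod p"])
qed (use assms in \<open>auto simp: mod_diff_eq\<close>)

lemma block_index_less:
  fixes n p i a :: nat
  assumes "i < p" "a < n"
  shows "i * n + a < n * p"
proof -
  have "i * n + a < (i + 1) * n" using assms by simp
  also have "\<dots> \<le> p * n" using assms by (intro mult_right_mono) auto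
  finally show ?thesis by (simp add: mult.commute)
qed

text \<open>Division with remainder by \<open>n\<close> is a bijection between flat indices and
  pairs of block and position. It converts sums in matrix products into sums over slices; for
  \<open>n = 0\<close> both sides are empty sums.\<close>

lemma sum_div_mod:
  fixes f :: "nat \<Rightarrow> nat \<Rightarrow> 'a::comm_monoid_add"
  shows "(\<Sum>r<n * p. f (r div n) (r mod n)) = (\<Sum>l<p. \<Sum>a<n. f l a)"
proof (cases "n = 0")
  case False
  show ?thesis
    unfolding sum.cartesian_product
    by (rule sum.reindex_bij_witness[where i = "\<lambda>(l, a). l * n + a" and j = "\<lambda>r. (r div n, r mod n)"])
      (use False in \<open>auto simp: block_index_less less_mult_imp_div_less mult.commute\<close>)
qed auto

lemma block_index_divmod:
  fixes n p i :: nat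
  assumes "i < n * p"
  shows "i div n < p" "i mod n < n"
  using assms by (auto simp: less_mult_imp_div_less mult.commute intro!: mod_less_divisor gr0I)

lemma mat_mult_index:
  assumes "A \<in> carrier_mat a b" "B \<in> carrier_mat b c" "i < a" "j < c"
  shows "(A * B) $$ (i, j) = (\<Sum>r<b. A $$ (i, r) * B $$ (r, j))"
  using assms by (simp add: scalar_prod_def lessThan_atLeast0)

subsection \<open>Algebra of tensors\<close>

lemma tensor_spaceD:
  assumes "A \<in> tensor_space m n p"
  shows "length A = p" "k < p \<Longrightarrow> A ! k \<in> carrier_mat m n"
    "k < p \<Longrightarrow> dim_row (A ! k) = m" "k < p \<Longrightarrow> dim_col (A ! k) = n"
    "0 < p \<Longrightarrow> t_rows A = m" "0 < p \<Longrightarrow> t_cols A = n"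
  using assms by (auto simp: tensor_space_def t_rows_def t_cols_def dest!: nth_mem)

lemma tensor_spaceI:
  assumes "length A = p" "\<And>k. k < p \<Longrightarrow> A ! k \<in> carrier_mat m n"
  shows "A \<in> tensor_space m n p"
  using assms by (auto simp: tensor_space_def in_set_conv_nth subset_iff)

lemma tensor_eqI:
  assumes A: "A \<in> tensor_space m n p" and B: "B \<in> tensor_space m n p"
    and "\<And>k i j. k < p \<Longrightarrow> i < m \<Longrightarrow> j < n \<Longrightarrow> (A ! k) $$ (i, j) = (B ! k) $$ (i, j)"
  shows "A = B"
  by (rule nth_equalityI)
    (auto simp: tensor_spaceD[OF A] tensor_spaceD[OF B] intro!: eq_matI assms(3))

lemma tadd_space:
  assumes "A \<in> tensor_space m n p" "B \<in> tensor_space m n p"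
  shows "A \<oplus>\<^sub>t B \<in> tensor_space m n p"
  using tensor_spaceD[OF assms(1)] tensor_spaceD[OF assms(2)]
  by (auto simp: tadd_def intro!: tensor_spaceI)

lemma tminus_space:
  assumes "A \<in> tensor_space m n p" "B \<in> tensor_space m n p"
  shows "A \<ominus>\<^sub>t B \<in> tensor_space m n p"
  using tensor_spaceD[OF assms(1)] tensor_spaceD[OF assms(2)]
  by (auto simp: tminus_def intro!: tensor_spaceI minus_carrier_mat)

lemma tuminus_space:
  assumes "A \<in> tensor_space m n p"
  shows "tuminus A \<in> tensor_space m n p"
  using tensor_spaceD[OF assms] by (auto simp: tuminus_def intro!: tensor_spaceI)

lemma tsmult_space:
  assumes "A \<in> tensor_space m n p"
  shows "c \<cdot>\<^sub>t A \<in> tensor_space m n p"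
  using tensor_spaceD[OF assms] by (auto simp: tsmult_def intro!: tensor_spaceI)

lemma tid_space: "tid n p \<in> tensor_space n n p"
  by (auto simp: tid_def intro!: tensor_spaceI)

lemma ttranspose_space:
  assumes "A \<in> tensor_space m n p"
  shows "A\<^sup>\<top> \<in> tensor_space n m p"
  using tensor_spaceD[OF assms] by (auto simp: ttranspose_def intro!: tensor_spaceI)

lemma tprod_space:
  assumes "0 < p" and A: "A \<in> tensor_space m n p" and B: "B \<in> tensor_space n s p"
  shows "A \<star> B \<in> tensor_space m s p"
  using assms(1) tensor_spaceD[OF A] tensor_spaceD[OF B]
  by (auto simp: tprod_def fold_tensor_def bcirc_def unfold_def Let_def intro!: tensor_spaceI)

lemma tadd_index:
  assumes "A \<in> tensor_space m n p" "B \<in> tensor_space m n p" "k < p" "i < m" "j < n"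
  shows "((A \<oplus>\<^sub>t B) ! k) $$ (i, j) = (A ! k) $$ (i, j) + (B ! k) $$ (i, j)"
  using tensor_spaceD[OF assms(1)] tensor_spaceD[OF assms(2)] assms(3-)
  by (auto simp: tadd_def)

lemma tminus_index:
  assumes "A \<in> tensor_space m n p" "B \<in> tensor_space m n p" "k < p" "i < m" "j < n"
  shows "((A \<ominus>\<^sub>t B) ! k) $$ (i, j) = (A ! k) $$ (i, j) - (B ! k) $$ (i, j)"
  using tensor_spaceD[OF assms(1)] tensor_spaceD[OF assms(2)] assms(3-)
  by (auto simp: tminus_def)

lemma tuminus_index:
  assumes "A \<in> tensor_space m n p" "k < p" "i < m" "j < n"
  shows "(tuminus A ! k) $$ (i, j) = - (A ! k) $$ (i, j)"
  using tensor_spaceD[OF assms(1)] assms(2-) by (auto simp: tuminus_def)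

lemma tsmult_index:
  assumes "A \<in> tensor_space m n p" "k < p" "i < m" "j < n"
  shows "((c \<cdot>\<^sub>t A) ! k) $$ (i, j) = c * (A ! k) $$ (i, j)"
  using tensor_spaceD[OF assms(1)] assms(2-) by (auto simp: tsmult_def)

lemma ttranspose_index:
  assumes "A \<in> tensor_space m n p" "k < p" "i < m" "j < n"
  shows "(A\<^sup>\<top> ! k) $$ (j, i) = (A ! (if k = 0 then 0 else p - k)) $$ (i, j)"
  using tensor_spaceD[OF assms(1)] assms(2-) by (auto simp: ttranspose_def)

lemma tid_index:
  assumes "k < p" "i < n" "j < n"
  shows "(tid n p ! k) $$ (i, j) = (if k = 0 \<and> i = j then 1 else 0)"
  using assms by (auto simp: tid_def)

section \<open>Block circulant matrices and the T-product\<close>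

lemma bcirc_carrier:
  assumes "A \<in> tensor_space m n p" "0 < p"
  shows "bcirc A \<in> carrier_mat (m * p) (n * p)"
  using assms tensor_spaceD[OF assms(1)] by (auto simp: bcirc_def Let_def)

lemma bcirc_index:
  assumes "A \<in> tensor_space m n p" "0 < p" "i < m * p" "j < n * p"
  shows "bcirc A $$ (i, j) = (A ! ((i div m + p - j div n) mod p)) $$ (i mod m, j mod n)"
  using assms tensor_spaceD[OF assms(1)] by (auto simp: bcirc_def Let_def)

lemma unfold_carrier:
  assumes "A \<in> tensor_space m n p" "0 < p"
  shows "unfold A \<in> carrier_mat (m * p) n"
  using assms tensor_spaceD[OF assms(1)] by (auto simp: unfold_def Let_def)

lemma unfold_index:
  assumes "A \<in> tensor_space m n p" "0 < p" "i < m * p" "j < n"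
  shows "unfold A $$ (i, j) = (A ! (i div m)) $$ (i mod m, j)"
  using assms tensor_spaceD[OF assms(1)] by (auto simp: unfold_def Let_def)

lemma unfold_inj:
  assumes A: "A \<in> tensor_space m n p" and B: "B \<in> tensor_space m n p" and "0 < p"
    and "unfold A = unfold B"
  shows "A = B"
proof (rule tensor_eqI[OF A B])
  fix k i j assume *: "k < p" "i < m" "j < n"
  have "unfold A $$ (k * m + i, j) = unfold B $$ (k * m + i, j)" by (simp only: assms(4))
  then show "(A ! k) $$ (i, j) = (B ! k) $$ (i, j)"
    using * assms(3) by (simp add: unfold_index[OF A] unfold_index[OF B] block_index_less)
qed

text \<open>The first block column already contains every slice: in row \<open>k * m + i\<close> and
  a column \<open>j < n\<close> the block index is \<open>k - 0\<close>, so comparing entries there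
  suffices.\<close>

lemma bcirc_inj:
  assumes A: "A \<in> tensor_space m n p" and B: "B \<in> tensor_space m n p" and "0 < p"
    and "bcirc A = bcirc B"
  shows "A = B"
proof (rule tensor_eqI[OF A B])
  fix k i j assume *: "k < p" "i < m" "j < n"
  have "bcirc A $$ (k * m + i, j) = bcirc B $$ (k * m + i, j)" by (simp only: assms(4))
  moreover have "j < n * p" using * \<open>0 < p\<close> block_index_less[of 0 p j n] by simp
  ultimately show "(A ! k) $$ (i, j) = (B ! k) $$ (i, j)"
    using * assms(3) by (simp add: bcirc_index[OF A] bcirc_index[OF B] block_index_less)
qed

lemma unfold_tprod:
  assumes "0 < p" and A: "A \<in> tensor_space m n p" and B: "B \<in> tensor_space n s p"
  shows "unfold (A \<star> B) = bcirc A * unfold B"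
proof (rule eq_matI)
  fix i j assume "i < dim_row (bcirc A * unfold B)" "j < dim_col (bcirc A * unfold B)"
  then have *: "i < m * p" "j < s"
    using bcirc_carrier[OF A] unfold_carrier[OF B] \<open>0 < p\<close> by auto
  have "unfold (A \<star> B) $$ (i, j) = ((A \<star> B) ! (i div m)) $$ (i mod m, j)"
    using unfold_index[OF tprod_space[OF assms]] * \<open>0 < p\<close> by simp
  also have "\<dots> = (bcirc A * unfold B) $$ (i, j)"
    using * block_index_divmod[OF *(1)] assms(1) bcirc_carrier[OF A] unfold_carrier[OF B]
      tensor_spaceD(1)[OF A]
    by (simp add: tprod_def fold_tensor_def Let_def)
  finally show "unfold (A \<star> B) $$ (i, j) = (bcirc A * unfold B) $$ (i, j)" .
qed (use unfold_carrier[OF tprod_space[OF assms]] bcirc_carrier[OF A] unfold_carrier[OF B] assms(1) in auto)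

lemma tprod_index:
  assumes "0 < p" and A: "A \<in> tensor_space m n p" and B: "B \<in> tensor_space n s p"
    and "k < p" "i < m" "j < s"
  shows "((A \<star> B) ! k) $$ (i, j) =
    (\<Sum>l<p. \<Sum>r<n. (A ! ((k + p - l) mod p)) $$ (i, r) * (B ! l) $$ (r, j))"
proof -
  have ix: "k * m + i < m * p" using assms by (simp add: block_index_less)
  have "((A \<star> B) ! k) $$ (i, j) = unfold (A \<star> B) $$ (k * m + i, j)"
    using assms ix by (simp add: unfold_index[OF tprod_space[OF assms(1) A B]])
  also have "\<dots> = (\<Sum>r<n * p. bcirc A $$ (k * m + i, r) * unfold B $$ (r, j))"
    unfolding unfold_tprod[OF assms(1) A B]
    using ix assms bcirc_carrier[OF A] unfold_carrier[OF B]
    by (simp add: scalar_prod_def lessThan_atLeast0)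
  also have "\<dots> = (\<Sum>r<n * p. (A ! ((k + p - r div n) mod p)) $$ (i, r mod n) * (B ! (r div n)) $$ (r mod n, j))"
    using ix assms by (intro sum.cong refl) (simp add: bcirc_index[OF A] unfold_index[OF B])
  also have "\<dots> = (\<Sum>l<p. \<Sum>r<n. (A ! ((k + p - l) mod p)) $$ (i, r) * (B ! l) $$ (r, j))"
    by (rule sum_div_mod)
  finally show ?thesis .
qed

text \<open>The homomorphism property that transfers laws of matrices to tensors. Block
  \<open>(I, J)\<close> on the left is a cyclic convolution at \<open>I - J\<close>; shifting its
  summation index by \<open>J\<close> gives the slices \<open>I - l\<close> of \<open>A\<close> and
  \<open>l - J\<close> of \<open>B\<close>, which is the block sum of the matrix product.\<close>

lemma bcirc_tprod:
  assumes "0 < p" and A: "A \<in> tensor_space m n p" and B: "B \<in> tensor_space n s p"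
  shows "bcirc (A \<star> B) = bcirc A * bcirc B"
proof (rule eq_matI)
  note AB = tprod_space[OF assms]
  fix i j assume "i < dim_row (bcirc A * bcirc B)" "j < dim_col (bcirc A * bcirc B)"
  then have *: "i < m * p" "j < s * p"
    using bcirc_carrier[OF A] bcirc_carrier[OF B] \<open>0 < p\<close> by auto
  note dm = block_index_divmod[OF *(1)] block_index_divmod[OF *(2)]
  define I J where "I = i div m" and "J = j div s"
  have IJ: "I < p" "J < p" using dm by (auto simp: I_def J_def)
  \<comment> \<open>The shift by \<open>J\<close> cancels in the cyclic difference of
    \<open>I - J\<close> and \<open>l - J\<close>.\<close>
  have sh: "((I + p - J) mod p + p - (l + p - J) mod p) mod p = (I + p - l) mod p" if "l < p" for l
    using that IJ by (subst mod_diff_eq) (auto simp: mod_diff_eq)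
  have "bcirc (A \<star> B) $$ (i, j) = (\<Sum>l<p. \<Sum>r<n.
      (A ! (((I + p - J) mod p + p - l) mod p)) $$ (i mod m, r) * (B ! l) $$ (r, j mod s))"
    using dm * assms(1) by (simp add: bcirc_index[OF AB] tprod_index[OF assms] I_def J_def)
  also have "\<dots> = (\<Sum>l<p. \<Sum>r<n.
      (A ! (((I + p - J) mod p + p - (l + p - J) mod p) mod p)) $$ (i mod m, r) * (B ! ((l + p - J) mod p)) $$ (r, j mod s))"
    by (rule sum_mod_shift[OF IJ(2), symmetric])
  also have "\<dots> = (\<Sum>l<p. \<Sum>r<n.
      (A ! ((I + p - l) mod p)) $$ (i mod m, r) * (B ! ((l + p - J) mod p)) $$ (r, j mod s))"
    by (intro sum.cong refl) (simp add: sh)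
  also have "\<dots> = (\<Sum>r<n * p. (A ! ((I + p - r div n) mod p)) $$ (i mod m, r mod n) *
      (B ! ((r div n + p - J) mod p)) $$ (r mod n, j mod s))"
    by (rule sum_div_mod[symmetric])
  also have "\<dots> = (\<Sum>r<n * p. bcirc A $$ (i, r) * bcirc B $$ (r, j))"
    using * assms(1) by (intro sum.cong refl) (simp add: bcirc_index[OF A] bcirc_index[OF B] I_def J_def)
  also have "\<dots> = (bcirc A * bcirc B) $$ (i, j)"
    using * bcirc_carrier[OF A] bcirc_carrier[OF B] assms(1)
    by (simp add: scalar_prod_def lessThan_atLeast0)
  finally show "bcirc (A \<star> B) $$ (i, j) = (bcirc A * bcirc B) $$ (i, j)" .
qed (use bcirc_carrier[OF tprod_space[OF assms]] bcirc_carrier[OF A] bcirc_carrier[OF B] assms(1) in auto)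

lemma tprod_assoc:
  assumes p: "0 < p" and A: "A \<in> tensor_space m n p" and B: "B \<in> tensor_space n s p"
    and C: "C \<in> tensor_space s t p"
  shows "A \<star> B \<star> C = A \<star> (B \<star> C)"
proof (rule unfold_inj)
  note AB = tprod_space[OF p A B] and BC = tprod_space[OF p B C]
  show "A \<star> B \<star> C \<in> tensor_space m t p" "A \<star> (B \<star> C) \<in> tensor_space m t p"
    by (rule tprod_space[OF p AB C], rule tprod_space[OF p A BC])
  show "unfold (A \<star> B \<star> C) = unfold (A \<star> (B \<star> C))"
    unfolding unfold_tprod[OF p AB C] unfold_tprod[OF p A BC] unfold_tprod[OF p B C]
      bcirc_tprod[OF p A B]
    by (rule assoc_mult_mat[OF bcirc_carrier[OF A p] bcirc_carrier[OF B p] unfold_carrier[OF C p]])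
qed (rule p)

text \<open>Reversing the slices after slice 0 negates the slice index modulo \<open>p\<close>, and
  exchanging block row and block column does the same to a cyclic difference.\<close>

lemma bcirc_ttranspose:
  assumes p: "0 < p" and A: "A \<in> tensor_space m n p"
  shows "bcirc (A\<^sup>\<top>) = (bcirc A)\<^sup>T"
proof (rule eq_matI)
  note AT = ttranspose_space[OF A]
  fix i j assume "i < dim_row (bcirc A)\<^sup>T" "j < dim_col (bcirc A)\<^sup>T"
  then have *: "i < n * p" "j < m * p" using bcirc_carrier[OF A p] by auto
  note dm = block_index_divmod[OF *(1)] block_index_divmod[OF *(2)]
  have "(let k = (i div n + p - j div m) mod p in if k = 0 then 0 else p - k)
      = (j div m + p - i div n) mod p"
    using dm by (auto simp: mod_diff_eq Let_def)
  then show "bcirc (A\<^sup>\<top>) $$ (i, j) = (bcirc A)\<^sup>T $$ (i, j)"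
    using dm * p bcirc_carrier[OF A p]
    by (simp add: bcirc_index[OF AT] bcirc_index[OF A] ttranspose_index[OF A] Let_def)
qed (use bcirc_carrier[OF A p] bcirc_carrier[OF ttranspose_space[OF A] p] in auto)

lemma ttranspose_tprod:
  assumes p: "0 < p" and A: "A \<in> tensor_space m n p" and B: "B \<in> tensor_space n s p"
  shows "(A \<star> B)\<^sup>\<top> = B\<^sup>\<top> \<star> A\<^sup>\<top>"
proof (rule bcirc_inj)
  note AB = tprod_space[OF p A B] and AT = ttranspose_space[OF A] and BT = ttranspose_space[OF B]
  show "(A \<star> B)\<^sup>\<top> \<in> tensor_space s m p" "B\<^sup>\<top> \<star> A\<^sup>\<top> \<in> tensor_space s m p"
    by (rule ttranspose_space[OF AB], rule tprod_space[OF p BT AT])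
  show "bcirc ((A \<star> B)\<^sup>\<top>) = bcirc (B\<^sup>\<top> \<star> A\<^sup>\<top>)"
    unfolding bcirc_ttranspose[OF p AB] bcirc_tprod[OF p BT AT] bcirc_tprod[OF p A B]
      bcirc_ttranspose[OF p A] bcirc_ttranspose[OF p B]
    by (rule transpose_mult[OF bcirc_carrier[OF A p] bcirc_carrier[OF B p]])
qed (rule p)

lemma ttranspose_ttranspose:
  assumes A: "A \<in> tensor_space m n p"
  shows "(A\<^sup>\<top>)\<^sup>\<top> = A"
proof (rule tensor_eqI[OF ttranspose_space[OF ttranspose_space[OF A]] A])
  fix k i j assume "k < p" "i < m" "j < n"
  then show "((A\<^sup>\<top>)\<^sup>\<top> ! k) $$ (i, j) = (A ! k) $$ (i, j)"
    by (cases "k = 0")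
      (auto simp: ttranspose_index[OF ttranspose_space[OF A]] ttranspose_index[OF A])
qed

section \<open>Bilinearity of the T-product\<close>

lemma tprod_tadd_right:
  assumes p: "0 < p" and A: "A \<in> tensor_space m n p" and B: "B \<in> tensor_space n s p"
    and C: "C \<in> tensor_space n s p"
  shows "A \<star> (B \<oplus>\<^sub>t C) = A \<star> B \<oplus>\<^sub>t A \<star> C"
proof (rule tensor_eqI)
  show "A \<star> (B \<oplus>\<^sub>t C) \<in> tensor_space m s p" "A \<star> B \<oplus>\<^sub>t A \<star> C \<in> tensor_space m s p"
    using assms by (auto intro!: tprod_space tadd_space)
qed (simp add: tprod_index[OF p A tadd_space[OF B C]] tadd_index[OF tprod_space[OF p A B] tprod_space[OF p A C]]
   tprod_index[OF p A B] tprod_index[OF p A C] tadd_index[OF B C] sum.distrib distrib_left)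

lemma tprod_tsmult_right:
  assumes p: "0 < p" and A: "A \<in> tensor_space m n p" and B: "B \<in> tensor_space n s p"
  shows "A \<star> (c \<cdot>\<^sub>t B) = c \<cdot>\<^sub>t (A \<star> B)"
proof (rule tensor_eqI)
  show "A \<star> (c \<cdot>\<^sub>t B) \<in> tensor_space m s p" "c \<cdot>\<^sub>t (A \<star> B) \<in> tensor_space m s p"
    using assms by (auto intro!: tprod_space tsmult_space)
qed (simp add: tprod_index[OF p A tsmult_space[OF B]] tsmult_index[OF tprod_space[OF p A B]]
   tprod_index[OF p A B] tsmult_index[OF B] sum_distrib_left mult.left_commute)

lemma tprod_tadd_left:
  assumes p: "0 < p" and A: "A \<in> tensor_space m n p" and B: "B \<in> tensor_space m n p"
    and C: "C \<in> tensor_space n s p"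
  shows "(A \<oplus>\<^sub>t B) \<star> C = A \<star> C \<oplus>\<^sub>t B \<star> C"
proof (rule tensor_eqI)
  show "(A \<oplus>\<^sub>t B) \<star> C \<in> tensor_space m s p" "A \<star> C \<oplus>\<^sub>t B \<star> C \<in> tensor_space m s p"
    using assms by (auto intro!: tprod_space tadd_space)
qed (simp add: tprod_index[OF p tadd_space[OF A B] C] tadd_index[OF tprod_space[OF p A C] tprod_space[OF p B C]]
   tprod_index[OF p A C] tprod_index[OF p B C] tadd_index[OF A B] sum.distrib distrib_right)

lemma tprod_tsmult_left:
  assumes p: "0 < p" and A: "A \<in> tensor_space m n p" and B: "B \<in> tensor_space n s p"
  shows "(c \<cdot>\<^sub>t A) \<star> B = c \<cdot>\<^sub>t (A \<star> B)"
proof (rule tensor_eqI)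
  show "(c \<cdot>\<^sub>t A) \<star> B \<in> tensor_space m s p" "c \<cdot>\<^sub>t (A \<star> B) \<in> tensor_space m s p"
    using assms by (auto intro!: tprod_space tsmult_space)
qed (simp add: tprod_index[OF p tsmult_space[OF A] B] tsmult_index[OF tprod_space[OF p A B]]
   tprod_index[OF p A B] tsmult_index[OF A] sum_distrib_left mult.assoc)

text \<open>Reduces differences to sums and scalar multiples, for which the distributive laws above
  are available.\<close>

lemma tminus_eq_tadd:
  assumes "A \<in> tensor_space m n p" "B \<in> tensor_space m n p"
  shows "A \<ominus>\<^sub>t B = A \<oplus>\<^sub>t (- 1) \<cdot>\<^sub>t B"
  by (rule tensor_eqI[OF tminus_space[OF assms] tadd_space[OF assms(1) tsmult_space[OF assms(2)]]])
    (simp add: tminus_index[OF assms] tadd_index[OF assms(1) tsmult_space[OF assms(2)]] tsmult_index[OF assms(2)])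

lemma tuminus_eq_tsmult: "tuminus A = (- 1) \<cdot>\<^sub>t A"
  unfolding tuminus_def tsmult_def by (rule map_cong) (auto intro!: eq_matI)

text \<open>For a tube \<open>c\<close> this is the explicit value of
  \<open>c \<otimes>\<^sub>t tid n p\<close>, as \<open>tkron_tid\<close> shows, in a form free of
  Fourier matrices and definite descriptions.\<close>

definition tube_diag :: "nat \<Rightarrow> tensor \<Rightarrow> tensor" where
  "tube_diag n c = map (\<lambda>M. (M $$ (0, 0)) \<cdot>\<^sub>m 1\<^sub>m n) c"

lemma tube_diag_space: "length c = p \<Longrightarrow> tube_diag n c \<in> tensor_space n n p"
  by (auto simp: tube_diag_def intro!: tensor_spaceI)

lemma tube_diag_index:
  assumes "k < length c" "i < n" "j < n"
  shows "(tube_diag n c ! k) $$ (i, j) = (if i = j then (c ! k) $$ (0, 0) else 0)"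
  using assms by (auto simp: tube_diag_def)

lemma tube_diag_one:
  assumes c: "c \<in> tensor_space 1 1 p"
  shows "tube_diag 1 c = c"
  by (rule tensor_eqI[OF tube_diag_space c]) (use tensor_spaceD(1)[OF c] in \<open>auto simp: tube_diag_index\<close>)

text \<open>Both sides convolve \<open>c\<close> cyclically with each tube of \<open>X\<close>, and
  cyclic convolution is commutative. It lets a tube acting on \<open>X\<close> from the left be
  moved to the right, where associativity applies; the case \<open>n = 1\<close> makes tubes
  commute.\<close>

lemma tube_diag_tprod:
  assumes p: "0 < p" and c: "c \<in> tensor_space 1 1 p" and X: "X \<in> tensor_space n 1 p"
  shows "tube_diag n c \<star> X = X \<star> c"
proof (rule tensor_eqI)
  have D: "tube_diag n c \<in> tensor_space n n p" using tensor_spaceD(1)[OF c] by (rule tube_diag_space)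
  show "tube_diag n c \<star> X \<in> tensor_space n 1 p" "X \<star> c \<in> tensor_space n 1 p"
    using p c X D by (auto intro: tprod_space)
  fix k i j :: nat assume *: "k < p" "i < n" "j < 1"
  have "((tube_diag n c \<star> X) ! k) $$ (i, j) =
      (\<Sum>l<p. \<Sum>r<n. (if i = r then (c ! ((k + p - l) mod p)) $$ (0, 0) * (X ! l) $$ (r, 0) else 0))"
    unfolding tprod_index[OF p D X *]
    using * p tensor_spaceD(1)[OF c] by (intro sum.cong refl) (auto simp: tube_diag_index)
  also have "\<dots> = (\<Sum>l<p. (c ! ((k + p - l) mod p)) $$ (0, 0) * (X ! l) $$ (i, 0))"
    using * by (simp add: sum.delta)
  also have "\<dots> = (\<Sum>l<p. (c ! l) $$ (0, 0) * (X ! ((k + p - l) mod p)) $$ (i, 0))"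
    using sum_mod_reflect[OF *(1), of "\<lambda>a b. (c ! a) $$ (0, 0) * (X ! b) $$ (i, 0)"] .
  also have "\<dots> = ((X \<star> c) ! k) $$ (i, j)"
    using * by (simp add: tprod_index[OF p X c] mult.commute)
  finally show "((tube_diag n c \<star> X) ! k) $$ (i, j) = ((X \<star> c) ! k) $$ (i, j)" .
qed

lemma tube_commute:
  assumes "0 < p" "a \<in> tensor_space 1 1 p" "b \<in> tensor_space 1 1 p"
  shows "a \<star> b = b \<star> a"
  using tube_diag_tprod[OF assms] tube_diag_one[OF assms(2)] by simp

lemma tprod_tid_right:
  assumes p: "0 < p" and A: "A \<in> tensor_space m n p"
  shows "A \<star> tid n p = A"
proof (rule tensor_eqI[OF tprod_space[OF p A tid_space] A])
  fix k i j assume *: "k < p" "i < m" "j < n"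
  have "((A \<star> tid n p) ! k) $$ (i, j) =
      (\<Sum>l<p. if l = 0 then (A ! ((k + p - l) mod p)) $$ (i, j) else 0)"
    unfolding tprod_index[OF p A tid_space *]
  proof (intro sum.cong refl)
    fix l assume "l \<in> {..<p}"
    with * show "(\<Sum>r<n. (A ! ((k + p - l) mod p)) $$ (i, r) * (tid n p ! l) $$ (r, j)) =
        (if l = 0 then (A ! ((k + p - l) mod p)) $$ (i, j) else 0)"
      by (cases "l = 0") (simp_all add: tid_index if_distrib[of "times _"] cong: if_cong)
  qed
  also have "\<dots> = (A ! k) $$ (i, j)"
    using * p by (simp add: sum.delta)
  finally show "((A \<star> tid n p) ! k) $$ (i, j) = (A ! k) $$ (i, j)" .
qed

subsection \<open>The Frobenius inner product\<close>

text \<open>The bilinear form behind \<open>tnorm\<close>. First-order terms of the Lagrangian are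
  such inner products, and the adjoint rules below isolate the direction of differentiation in them.
  The format is read off the first argument.\<close>

definition tinner :: "tensor \<Rightarrow> tensor \<Rightarrow> real" where
  "tinner A B = (\<Sum>k<length A. \<Sum>i<t_rows A. \<Sum>j<t_cols A. (A ! k) $$ (i, j) * (B ! k) $$ (i, j))"

lemma tinner_eq:
  assumes "A \<in> tensor_space m n p" "0 < p"
  shows "tinner A B = (\<Sum>k<p. \<Sum>i<m. \<Sum>j<n. (A ! k) $$ (i, j) * (B ! k) $$ (i, j))"
  using tensor_spaceD[OF assms(1)] assms(2) by (simp add: tinner_def)

lemma tnorm_squared: "(tnorm A)\<^sup>2 = tinner A A"
  unfolding tnorm_def tinner_def power2_eq_square[of "sqrt _"]
  by (subst real_sqrt_mult_self) (auto intro!: abs_of_nonneg sum_nonneg simp: power2_eq_square)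

lemma tinner_commute:
  assumes "A \<in> tensor_space m n p" "B \<in> tensor_space m n p" "0 < p"
  shows "tinner A B = tinner B A"
  by (simp add: tinner_eq[OF assms(1,3)] tinner_eq[OF assms(2,3)] mult.commute)

lemma tinner_unfold:
  assumes A: "A \<in> tensor_space m n p" and B: "B \<in> tensor_space m n p" and p: "0 < p"
  shows "tinner A B = (\<Sum>i<m * p. \<Sum>j<n. unfold A $$ (i, j) * unfold B $$ (i, j))"
proof -
  have "(\<Sum>i<m * p. \<Sum>j<n. unfold A $$ (i, j) * unfold B $$ (i, j)) =
      (\<Sum>r<m * p. \<Sum>j<n. (A ! (r div m)) $$ (r mod m, j) * (B ! (r div m)) $$ (r mod m, j))"
    by (intro sum.cong refl) (simp add: unfold_index[OF A p] unfold_index[OF B p])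
  also have "\<dots> = tinner A B"
    unfolding tinner_eq[OF A p] by (rule sum_div_mod)
  finally show ?thesis ..
qed

text \<open>On unfoldings, left multiplication by \<open>A\<close> is the matrix
  \<open>bcirc A\<close>, whose adjoint is its transpose \<open>bcirc (A\<^sup>\<top>)\<close>. The
  steps in between only reorder a triple sum.\<close>

lemma tinner_tprod_left:
  assumes p: "0 < p" and A: "A \<in> tensor_space m n p" and B: "B \<in> tensor_space n s p"
    and C: "C \<in> tensor_space m s p"
  shows "tinner (A \<star> B) C = tinner B (A\<^sup>\<top> \<star> C)"
proof -
  note AT = ttranspose_space[OF A]
  have "tinner (A \<star> B) C = (\<Sum>i<m * p. \<Sum>j<s. \<Sum>r<n * p. bcirc A $$ (i, r) * unfold B $$ (r, j) * unfold C $$ (i, j))"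
    unfolding tinner_unfold[OF tprod_space[OF p A B] C p] unfold_tprod[OF p A B]
    using bcirc_carrier[OF A p] unfold_carrier[OF B p]
    by (simp add: scalar_prod_def lessThan_atLeast0 sum_distrib_right)
  also have "\<dots> = (\<Sum>r<n * p. \<Sum>i<m * p. \<Sum>j<s. bcirc A $$ (i, r) * unfold B $$ (r, j) * unfold C $$ (i, j))"
    by (subst sum.swap[of _ "{..<n * p}"]) (intro sum.cong refl sum.swap)
  also have "\<dots> = (\<Sum>r<n * p. \<Sum>j<s. \<Sum>i<m * p. unfold B $$ (r, j) * (bcirc A $$ (i, r) * unfold C $$ (i, j)))"
    by (subst (2) sum.swap) (simp only: ac_simps)
  also have "\<dots> = tinner B (A\<^sup>\<top> \<star> C)"
    unfolding tinner_unfold[OF B tprod_space[OF p AT C] p] unfold_tprod[OF p AT C] bcirc_ttranspose[OF p A]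
    using bcirc_carrier[OF A p] unfold_carrier[OF C p]
    by (simp add: scalar_prod_def lessThan_atLeast0 sum_distrib_left)
  finally show ?thesis .
qed

text \<open>Transposition merely permutes the entries, in the same way for both tensors: it swaps
  row and column and negates the slice index modulo \<open>p\<close>.\<close>

lemma tinner_ttranspose:
  assumes p: "0 < p" and A: "A \<in> tensor_space m n p" and B: "B \<in> tensor_space m n p"
  shows "tinner (A\<^sup>\<top>) (B\<^sup>\<top>) = tinner A B"
proof -
  \<comment> \<open>The summand \<open>0\<close> puts the index into the shape of
    \<open>sum_mod_reflect\<close> at index 0; removing \<open>add_0\<close> from the simplifier
    preserves that shape.\<close>
  have k: "(if k = 0 then 0 else p - k) = (0 + p - k) mod p" if "k < p" for k
    using that by auto
  have "tinner (A\<^sup>\<top>) (B\<^sup>\<top>) = (\<Sum>k<p. \<Sum>i<n. \<Sum>j<m. (A ! ((0 + p - k) mod p)) $$ (j, i) * (B ! ((0 + p - k) mod p)) $$ (j, i))"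
    unfolding tinner_eq[OF ttranspose_space[OF A] p]
    by (intro sum.cong refl) (simp add: ttranspose_index[OF A] ttranspose_index[OF B] k del: add_0)
  also have "\<dots> = (\<Sum>k<p. \<Sum>i<n. \<Sum>j<m. (A ! k) $$ (j, i) * (B ! k) $$ (j, i))"
    using sum_mod_reflect[OF p, of "\<lambda>k _. \<Sum>i<n. \<Sum>j<m. (A ! k) $$ (j, i) * (B ! k) $$ (j, i)"] .
  also have "\<dots> = tinner A B"
    unfolding tinner_eq[OF A p] by (intro sum.cong refl sum.swap)
  finally show ?thesis .
qed

text \<open>Transposing both arguments turns the right factor into a left factor, to which
  \<open>tinner_tprod_left\<close> applies.\<close>

lemma tinner_tprod_right:
  assumes p: "0 < p" and A: "A \<in> tensor_space m n p" and B: "B \<in> tensor_space n s p"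
    and C: "C \<in> tensor_space m s p"
  shows "tinner (A \<star> B) C = tinner A (C \<star> B\<^sup>\<top>)"
proof -
  note AT = ttranspose_space[OF A] and BT = ttranspose_space[OF B] and CT = ttranspose_space[OF C]
  have "tinner (A \<star> B) C = tinner (B\<^sup>\<top> \<star> A\<^sup>\<top>) (C\<^sup>\<top>)"
    using tinner_ttranspose[OF p tprod_space[OF p A B] C] ttranspose_tprod[OF p A B] by simp
  also have "\<dots> = tinner (A\<^sup>\<top>) (B \<star> C\<^sup>\<top>)"
    using tinner_tprod_left[OF p BT AT CT] ttranspose_ttranspose[OF B] by simp
  also have "B \<star> C\<^sup>\<top> = (C \<star> B\<^sup>\<top>)\<^sup>\<top>"
    using ttranspose_tprod[OF p C BT] ttranspose_ttranspose[OF B] by simp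
  also have "tinner (A\<^sup>\<top>) \<dots> = tinner A (C \<star> B\<^sup>\<top>)"
    by (rule tinner_ttranspose[OF p A tprod_space[OF p C BT]])
  finally show ?thesis .
qed

lemma tinner_line:
  assumes U: "U \<in> tensor_space m n p" and E: "E \<in> tensor_space m n p" and p: "0 < p"
  shows "tinner (U \<oplus>\<^sub>t h \<cdot>\<^sub>t E) (U \<oplus>\<^sub>t h \<cdot>\<^sub>t E) = tinner U U + 2 * h * tinner U E + h\<^sup>2 * tinner E E"
proof -
  note hE = tsmult_space[OF E, of h]
  have "tinner (U \<oplus>\<^sub>t h \<cdot>\<^sub>t E) (U \<oplus>\<^sub>t h \<cdot>\<^sub>t E) =
      (\<Sum>k<p. \<Sum>i<m. \<Sum>j<n. (U ! k) $$ (i, j) * (U ! k) $$ (i, j) +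
         2 * h * ((U ! k) $$ (i, j) * (E ! k) $$ (i, j)) + h\<^sup>2 * ((E ! k) $$ (i, j) * (E ! k) $$ (i, j)))"
    unfolding tinner_eq[OF tadd_space[OF U hE] p]
    by (intro sum.cong refl)
      (simp add: tadd_index[OF U hE] tsmult_index[OF E] power2_eq_square algebra_simps)
  also have "\<dots> = tinner U U + 2 * h * tinner U E + h\<^sup>2 * tinner E E"
    unfolding tinner_eq[OF U p] tinner_eq[OF E p] by (simp add: sum.distrib sum_distrib_left)
  finally show ?thesis .
qed

section \<open>The Lagrangian along coordinate lines and its partial derivatives\<close>

lemma tconcat_space:
  assumes A: "A \<in> tensor_space m n p" and B: "B \<in> tensor_space m s p"
  shows "tconcat A B \<in> tensor_space m (n + s) p"
  using tensor_spaceD[OF A] tensor_spaceD[OF B]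
  by (auto simp: tconcat_def intro!: tensor_spaceI)

lemma tconcat_index:
  assumes A: "A \<in> tensor_space m n p" and B: "B \<in> tensor_space m s p"
    and "k < p" "i < m" "j < n + s"
  shows "(tconcat A B ! k) $$ (i, j) = (if j < n then (A ! k) $$ (i, j) else (B ! k) $$ (i, j - n))"
  using tensor_spaceD[OF A] tensor_spaceD[OF B] assms(3-) by (auto simp: tconcat_def)

lemma sum_lessThan_add:
  fixes f :: "nat \<Rightarrow> 'a::comm_monoid_add"
  shows "(\<Sum>j<n + s. f j) = (\<Sum>j<n. f j) + (\<Sum>j<s. f (n + j))"
  by (induction s) (simp_all add: add.assoc)

lemma tnorm_tconcat_diff_squared:
  assumes A: "A \<in> tensor_space m n p" and B: "B \<in> tensor_space m s p"
    and C: "C \<in> tensor_space m n p" and D: "D \<in> tensor_space m s p" and p: "0 < p"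
  shows "(tnorm (tconcat A B \<ominus>\<^sub>t tconcat C D))\<^sup>2 =
    tinner (A \<ominus>\<^sub>t C) (A \<ominus>\<^sub>t C) + tinner (B \<ominus>\<^sub>t D) (B \<ominus>\<^sub>t D)"
proof -
  note AB = tconcat_space[OF A B] and CD = tconcat_space[OF C D]
  show ?thesis
    unfolding tnorm_squared tinner_eq[OF tminus_space[OF AB CD] p] tinner_eq[OF tminus_space[OF A C] p]
      tinner_eq[OF tminus_space[OF B D] p] sum_lessThan_add sum.distrib
    by (simp add: tminus_index[OF AB CD] tminus_index[OF A C] tminus_index[OF B D]
        tconcat_index[OF A B] tconcat_index[OF C D])
qed

definition tunit :: "nat \<Rightarrow> nat \<Rightarrow> nat \<Rightarrow> nat \<Rightarrow> nat \<Rightarrow> nat \<Rightarrow> tensor" where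
  "tunit m n p i j k = map (\<lambda>l. mat m n (\<lambda>(a, b). if l = k \<and> a = i \<and> b = j then 1 else 0)) [0..<p]"

lemma tunit_space: "tunit m n p i j k \<in> tensor_space m n p"
  by (auto simp: tunit_def intro!: tensor_spaceI)

lemma tunit_index:
  assumes "l < p" "a < m" "b < n"
  shows "(tunit m n p i j k ! l) $$ (a, b) = (if l = k \<and> a = i \<and> b = j then 1 else 0)"
  using assms by (auto simp: tunit_def)

lemma tinner_tunit:
  assumes A: "A \<in> tensor_space m n p" and "k < p" "i < m" "j < n"
  shows "tinner (tunit m n p i j k) A = (A ! k) $$ (i, j)"
proof -
  \<comment> \<open>The conjunction in \<open>tunit\<close> is nested so that the outermost test
    concerns the innermost summation variable; the three sums then collapse one after the other from
    the inside.\<close>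
  have "tinner (tunit m n p i j k) A = (\<Sum>l<p. \<Sum>a<m. \<Sum>b<n.
      if b = j then if l = k then if a = i then (A ! l) $$ (a, b) else 0 else 0 else 0)"
    using assms by (subst tinner_eq[OF tunit_space]; (intro sum.cong refl)?) (auto simp: tunit_index)
  also have "\<dots> = (\<Sum>l<p. \<Sum>a<m. if a = i then if l = k then (A ! l) $$ (a, j) else 0 else 0)"
    using assms by (intro sum.cong refl) simp
  also have "\<dots> = (\<Sum>l<p. if l = k then (A ! l) $$ (i, j) else 0)"
    using assms by (intro sum.cong refl) simp
  also have "\<dots> = (A ! k) $$ (i, j)" using assms by (simp add: sum.delta)
  finally show ?thesis .
qed

text \<open>Turns a partial derivative into a derivative along a line, where the algebra of tensors
  applies.\<close>

lemma tupdate_eq_tadd: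
  assumes T: "T \<in> tensor_space m n p" and "i < m" "j < n" "k < p"
  shows "tupdate T i j k x = T \<oplus>\<^sub>t (x - (T ! k) $$ (i, j)) \<cdot>\<^sub>t tunit m n p i j k"
proof (rule tensor_eqI)
  note D = tensor_spaceD[OF T] and E = tunit_space[of m n p i j k]
  show "T \<oplus>\<^sub>t (x - (T ! k) $$ (i, j)) \<cdot>\<^sub>t tunit m n p i j k \<in> tensor_space m n p"
    by (intro tadd_space tsmult_space T E)
  show "tupdate T i j k x \<in> tensor_space m n p"
  proof (rule tensor_spaceI)
    show "tupdate T i j k x ! l \<in> carrier_mat m n" if "l < p" for l
      using that D \<open>k < p\<close> by (cases "l = k") (simp_all add: tupdate_def)
  qed (simp add: tupdate_def D(1))
  show "(tupdate T i j k x ! l) $$ (a, b) =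
      ((T \<oplus>\<^sub>t (x - (T ! k) $$ (i, j)) \<cdot>\<^sub>t tunit m n p i j k) ! l) $$ (a, b)"
    if "l < p" "a < m" "b < n" for l a b
    using that assms(2-) D(1,3,4) by (auto simp: tupdate_def nth_list_update tadd_index[OF T tsmult_space[OF E]]
        tsmult_index[OF E] tunit_index)
qed

text \<open>Along a coordinate line \<open>f\<close> is a quadratic polynomial in the displacement
  \<open>h = x - t\<close> from the current entry \<open>t\<close>. Its derivative at
  \<open>t\<close> is the linear coefficient, and derivatives are unique.\<close>

lemma tensor_gradient_zeroD:
  assumes "tensor_gradient_zero f T" and T: "T \<in> tensor_space m n p" and "0 < p"
    and "i < m" "j < n" "k < p"
    and f: "\<And>h. f (T \<oplus>\<^sub>t h \<cdot>\<^sub>t tunit m n p i j k) = a + b * h + c * h\<^sup>2"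
  shows "b = 0"
proof -
  define t where "t = (T ! k) $$ (i, j)"
  have "((\<lambda>x. f (tupdate T i j k x)) has_real_derivative 0) (at t)"
    using assms tensor_spaceD[OF T] by (auto simp: tensor_gradient_zero_def t_def)
  moreover have "(\<lambda>x. f (tupdate T i j k x)) = (\<lambda>x. a + b * (x - t) + c * (x - t)\<^sup>2)"
    using assms by (simp add: tupdate_eq_tadd[OF T] t_def)
  moreover have "((\<lambda>x. a + b * (x - t) + c * (x - t)\<^sup>2) has_real_derivative b) (at t)"
    by (auto intro!: derivative_eq_intros)
  ultimately show "b = 0" by (metis DERIV_unique)
qed

lemma trtls_lagrangian_eq:
  assumes A: "A \<in> tensor_space m n p" and B: "B \<in> tensor_space m 1 p" and p: "0 < p"
    and At: "At \<in> tensor_space m n p" and X: "X \<in> tensor_space n 1 p"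
  shows "trtls_lagrangian A B K \<delta> At X \<mu> =
    tinner (A \<ominus>\<^sub>t At) (A \<ominus>\<^sub>t At) + tinner (B \<ominus>\<^sub>t At \<star> X) (B \<ominus>\<^sub>t At \<star> X) +
    \<mu> * (tinner (K \<star> X) (K \<star> X) - \<delta>\<^sup>2)"
  by (simp add: trtls_lagrangian_def tnorm_tconcat_diff_squared[OF A B At tprod_space[OF p At X] p]
    tnorm_squared[of "K \<star> X"])

lemma tminus_line:
  assumes A: "A \<in> tensor_space m n p" and B: "B \<in> tensor_space m n p" and E: "E \<in> tensor_space m n p"
  shows "A \<ominus>\<^sub>t (B \<oplus>\<^sub>t h \<cdot>\<^sub>t E) = (A \<ominus>\<^sub>t B) \<oplus>\<^sub>t (- h) \<cdot>\<^sub>t E"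
proof (rule tensor_eqI)
  show "A \<ominus>\<^sub>t (B \<oplus>\<^sub>t h \<cdot>\<^sub>t E) \<in> tensor_space m n p"
    "(A \<ominus>\<^sub>t B) \<oplus>\<^sub>t (- h) \<cdot>\<^sub>t E \<in> tensor_space m n p"
    using assms by (intro tadd_space tminus_space tsmult_space; simp)+
qed (simp add: tminus_index[OF A tadd_space[OF B tsmult_space[OF E]]] tadd_index[OF B tsmult_space[OF E]]
  tsmult_index[OF E] tadd_index[OF tminus_space[OF A B] tsmult_space[OF E]] tminus_index[OF A B])

text \<open>A step \<open>h\<close> along \<open>E\<close> changes the residuals
  \<open>A \<ominus>\<^sub>t At\<close> and \<open>R\<close> by \<open>- h\<close> times
  \<open>E\<close> and \<open>E \<star> X\<close>. Moving \<open>X\<close> to the other side of the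
  inner product shows that the gradient in \<open>At\<close> is \<open>- 2\<close> times \<open>(A
  \<ominus>\<^sub>t At) \<oplus>\<^sub>t R \<star> X\<^sup>\<top>\<close>.\<close>

lemma trtls_multiplier_At:
  assumes A: "A \<in> tensor_space m n p" and B: "B \<in> tensor_space m 1 p" and p: "0 < p"
    and At: "At \<in> tensor_space m n p" and X: "X \<in> tensor_space n 1 p"
    and "trtls_multiplier A B K \<delta> At X \<mu>"
  shows "At = A \<oplus>\<^sub>t (B \<ominus>\<^sub>t At \<star> X) \<star> X\<^sup>\<top>"
proof (rule tensor_eqI[OF At])
  define R where "R = B \<ominus>\<^sub>t At \<star> X"
  note AtX = tprod_space[OF p At X] and XT = ttranspose_space[OF X]
  have R: "R \<in> tensor_space m 1 p" unfolding R_def by (rule tminus_space[OF B AtX])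
  note RX = tprod_space[OF p R XT]
  have RX': "(B \<ominus>\<^sub>t At \<star> X) \<star> X\<^sup>\<top> \<in> tensor_space m n p" using RX by (simp add: R_def)
  show "A \<oplus>\<^sub>t (B \<ominus>\<^sub>t At \<star> X) \<star> X\<^sup>\<top> \<in> tensor_space m n p" by (rule tadd_space[OF A RX'])
  fix k i j assume ijk: "k < p" "i < m" "j < n"
  define E where "E = tunit m n p i j k"
  have E: "E \<in> tensor_space m n p" unfolding E_def by (rule tunit_space)
  note EX = tprod_space[OF p E X] and AAt = tminus_space[OF A At]
  \<comment> \<open>Grouped by powers of \<open>h\<close>, the form that
    \<open>tensor_gradient_zeroD\<close> expects.\<close>
  have "trtls_lagrangian A B K \<delta> (At \<oplus>\<^sub>t h \<cdot>\<^sub>t E) X \<mu> =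
      (tinner (A \<ominus>\<^sub>t At) (A \<ominus>\<^sub>t At) + tinner R R + \<mu> * (tinner (K \<star> X) (K \<star> X) - \<delta>\<^sup>2)) +
      (- 2 * (tinner (A \<ominus>\<^sub>t At) E + tinner R (E \<star> X))) * h + (tinner E E + tinner (E \<star> X) (E \<star> X)) * h\<^sup>2" for h
  proof -
    have "B \<ominus>\<^sub>t (At \<oplus>\<^sub>t h \<cdot>\<^sub>t E) \<star> X = R \<oplus>\<^sub>t (- h) \<cdot>\<^sub>t (E \<star> X)"
      unfolding tprod_tadd_left[OF p At tsmult_space[OF E] X] tprod_tsmult_left[OF p E X] R_def
      by (rule tminus_line[OF B AtX EX])
    then show ?thesis
      unfolding trtls_lagrangian_eq[OF A B p tadd_space[OF At tsmult_space[OF E]] X]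
      by (simp add: tminus_line[OF A At E] tinner_line[OF AAt E p] tinner_line[OF R EX p] algebra_simps)
  qed
  then have "- 2 * (tinner (A \<ominus>\<^sub>t At) E + tinner R (E \<star> X)) = 0"
    using tensor_gradient_zeroD[where f = "\<lambda>T. trtls_lagrangian A B K \<delta> T X \<mu>", OF _ At p ijk(2,3,1)]
      assms(6) unfolding trtls_multiplier_def E_def by blast
  moreover have "tinner R (E \<star> X) = tinner E (R \<star> X\<^sup>\<top>)"
    using tinner_commute[OF R EX p] tinner_tprod_right[OF p E X R] by simp
  ultimately have "tinner E (A \<ominus>\<^sub>t At) + tinner E (R \<star> X\<^sup>\<top>) = 0"
    using tinner_commute[OF AAt E p] by simp
  then show "(At ! k) $$ (i, j) = ((A \<oplus>\<^sub>t (B \<ominus>\<^sub>t At \<star> X) \<star> X\<^sup>\<top>) ! k) $$ (i, j)"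
    using tinner_tunit[OF AAt ijk] tinner_tunit[OF RX ijk] ijk
    by (simp add: E_def tminus_index[OF A At] tadd_index[OF A RX] flip: R_def)
qed

text \<open>Only \<open>R\<close> and the constraint term vary with \<open>X\<close>. The linear
  coefficient pairs \<open>R\<close> with \<open>At \<star> E\<close> and \<open>K \<star> X\<close>
  with \<open>K \<star> E\<close>; the adjoint rules free \<open>E\<close>, and running through all
  unit tensors \<open>E\<close> gives the identity entry by entry.\<close>

lemma trtls_multiplier_X:
  assumes A: "A \<in> tensor_space m n p" and B: "B \<in> tensor_space m 1 p" and p: "0 < p"
    and K: "K \<in> tensor_space q n p"
    and At: "At \<in> tensor_space m n p" and X: "X \<in> tensor_space n 1 p"
    and "trtls_multiplier A B K \<delta> At X \<mu>"
  shows "At\<^sup>\<top> \<star> (B \<ominus>\<^sub>t At \<star> X) = \<mu> \<cdot>\<^sub>t (K\<^sup>\<top> \<star> (K \<star> X))"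
proof (rule tensor_eqI)
  define R where "R = B \<ominus>\<^sub>t At \<star> X"
  note AtX = tprod_space[OF p At X] and KX = tprod_space[OF p K X]
  have R: "R \<in> tensor_space m 1 p" unfolding R_def by (rule tminus_space[OF B AtX])
  note AtR = tprod_space[OF p ttranspose_space[OF At] R] and KKX = tprod_space[OF p ttranspose_space[OF K] KX]
  show "At\<^sup>\<top> \<star> (B \<ominus>\<^sub>t At \<star> X) \<in> tensor_space n 1 p" using AtR by (simp add: R_def)
  show "\<mu> \<cdot>\<^sub>t (K\<^sup>\<top> \<star> (K \<star> X)) \<in> tensor_space n 1 p" by (rule tsmult_space[OF KKX])
  fix k i and j :: nat assume ijk: "k < p" "i < n" "j < 1"
  define E where "E = tunit n 1 p i j k"
  have E: "E \<in> tensor_space n 1 p" unfolding E_def by (rule tunit_space)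
  note AtE = tprod_space[OF p At E] and KE = tprod_space[OF p K E] and AAt = tminus_space[OF A At]
  have "trtls_lagrangian A B K \<delta> At (X \<oplus>\<^sub>t h \<cdot>\<^sub>t E) \<mu> =
      (tinner (A \<ominus>\<^sub>t At) (A \<ominus>\<^sub>t At) + tinner R R + \<mu> * (tinner (K \<star> X) (K \<star> X) - \<delta>\<^sup>2)) +
      (2 * (\<mu> * tinner (K \<star> X) (K \<star> E) - tinner R (At \<star> E))) * h +
      (tinner (At \<star> E) (At \<star> E) + \<mu> * tinner (K \<star> E) (K \<star> E)) * h\<^sup>2" for h
  proof -
    have "B \<ominus>\<^sub>t At \<star> (X \<oplus>\<^sub>t h \<cdot>\<^sub>t E) = R \<oplus>\<^sub>t (- h) \<cdot>\<^sub>t (At \<star> E)"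
      unfolding tprod_tadd_right[OF p At X tsmult_space[OF E]] tprod_tsmult_right[OF p At E] R_def
      by (rule tminus_line[OF B AtX AtE])
    moreover have "K \<star> (X \<oplus>\<^sub>t h \<cdot>\<^sub>t E) = K \<star> X \<oplus>\<^sub>t h \<cdot>\<^sub>t (K \<star> E)"
      unfolding tprod_tadd_right[OF p K X tsmult_space[OF E]] tprod_tsmult_right[OF p K E] ..
    ultimately show ?thesis
      unfolding trtls_lagrangian_eq[OF A B p At tadd_space[OF X tsmult_space[OF E]]]
      by (simp add: tinner_line[OF R AtE p] tinner_line[OF KX KE p] algebra_simps)
  qed
  then have "2 * (\<mu> * tinner (K \<star> X) (K \<star> E) - tinner R (At \<star> E)) = 0"
    using tensor_gradient_zeroD[where f = "\<lambda>Y. trtls_lagrangian A B K \<delta> At Y \<mu>", OF _ X p ijk(2,3,1)]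
      assms(7) unfolding trtls_multiplier_def E_def by blast
  moreover have "tinner R (At \<star> E) = tinner E (At\<^sup>\<top> \<star> R)"
    using tinner_commute[OF R AtE p] tinner_tprod_left[OF p At E R] by simp
  moreover have "tinner (K \<star> X) (K \<star> E) = tinner E (K\<^sup>\<top> \<star> (K \<star> X))"
    using tinner_commute[OF KX KE p] tinner_tprod_left[OF p K E KX] by simp
  ultimately have "tinner E (At\<^sup>\<top> \<star> R) = \<mu> * tinner E (K\<^sup>\<top> \<star> (K \<star> X))" by simp
  then show "((At\<^sup>\<top> \<star> (B \<ominus>\<^sub>t At \<star> X)) ! k) $$ (i, j) = ((\<mu> \<cdot>\<^sub>t (K\<^sup>\<top> \<star> (K \<star> X))) ! k) $$ (i, j)"
    using tinner_tunit[OF AtR ijk] tinner_tunit[OF KKX ijk] ijk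
    by (simp add: E_def tsmult_index[OF KKX] flip: R_def)
qed

subsection \<open>The Kronecker product with an identity tensor\<close>

abbreviation fourier_root :: "nat \<Rightarrow> complex" where
  "fourier_root p \<equiv> exp (- (2 * of_real pi * \<i> / of_nat p))"

text \<open>The conjugate has the positive angle with which \<open>bij_betw_roots_unity\<close>
  enumerates the roots of unity.\<close>

lemma fourier_root_power:
  "fourier_root p ^ k = cnj (cis (2 * pi * real k / real p))"
proof -
  have "fourier_root p = cis (- (2 * pi / real p))"
    by (simp add: cis_conv_exp mult_ac)
  then show ?thesis by (simp add: DeMoivre cis_cnj mult_ac)
qed

lemma fourier_root_power_eq_1: "0 < p \<Longrightarrow> fourier_root p ^ p = 1"
  by (simp add: fourier_root_power)

lemma fourier_root_power_mod:
  assumes "0 < p"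
  shows "fourier_root p ^ (k mod p) = fourier_root p ^ k"
proof -
  have "fourier_root p ^ k = fourier_root p ^ (p * (k div p) + k mod p)" by simp
  also have "\<dots> = fourier_root p ^ (k mod p)"
    using fourier_root_power_eq_1[OF assms] by (simp only: power_add power_mult power_one mult_1)
  finally show ?thesis ..
qed

lemma cnj_fourier_root_mult: "cnj (fourier_root p) ^ k * fourier_root p ^ k = 1"
proof -
  have "fourier_root p = cnj (cis (2 * pi / real p))"
    using fourier_root_power[of p 1] by simp
  then have "cnj (fourier_root p) * fourier_root p = 1"
    by (simp add: cis_cnj cis_mult)
  then show ?thesis by (metis power_mult_distrib power_one)
qed

text \<open>The sum is geometric with ratio \<open>z\<close> satisfying \<open>z ^ p = 1\<close>, so
  it vanishes unless \<open>z = 1\<close>, and \<open>z = 1\<close> happens only for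
  \<open>i = j\<close>.\<close>

lemma fourier_root_orthogonal:
  assumes "i < p" "j < p"
  shows "(\<Sum>k<p. cnj (fourier_root p) ^ (i * k) * fourier_root p ^ (j * k)) = (if i = j then of_nat p else 0)"
proof -
  define z where "z = cnj (fourier_root p) ^ i * fourier_root p ^ j"
  have zk: "cnj (fourier_root p) ^ (i * k) * fourier_root p ^ (j * k) = z ^ k" for k
    by (simp only: z_def power_mult_distrib power_mult)
  show ?thesis
  proof (cases "i = j")
    case True
    then have "z = 1" by (simp only: z_def cnj_fourier_root_mult)
    then show ?thesis using True zk by simp
  next
    case False
    have "z \<noteq> 1"
    proof
      assume "z = 1"
      \<comment> \<open>Inserting a factor 1 writes the \<open>j\<close>-th power as the
        \<open>i\<close>-th power times \<open>z\<close>; with \<open>z = 1\<close> two distinct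
        roots of unity would coincide.\<close>
      have "fourier_root p ^ j = (cnj (fourier_root p) ^ i * fourier_root p ^ i) * fourier_root p ^ j"
        by (simp only: cnj_fourier_root_mult mult_1)
      also have "\<dots> = fourier_root p ^ i * z" by (simp only: z_def ac_simps)
      finally have "cis (2 * pi * real i / real p) = cis (2 * pi * real j / real p)"
        unfolding \<open>z = 1\<close> fourier_root_power by simp
      then show False
        using bij_betw_roots_unity[of p] assms False
        by (auto simp: bij_betw_def inj_on_def)
    qed
    moreover have "z ^ p = 1"
    proof -
      have "z ^ p = cnj (fourier_root p ^ p) ^ i * (fourier_root p ^ p) ^ j"
        by (simp only: z_def power_mult_distrib flip: power_mult complex_cnj_power) (simp only: mult.commute)
      then show ?thesis using assms by (simp only: fourier_root_power_eq_1) simp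
    qed
    ultimately show ?thesis using False by (simp only: zk sum_gp_strict) simp
  qed
qed

lemma fourier_mat_index:
  assumes "i < p" "j < p"
  shows "fourier_mat p $$ (i, j) = fourier_root p ^ (i * j) / of_real (sqrt (of_nat p))"
  using assms by (simp add: fourier_mat_def)

lemma fourier_mat_carrier: "fourier_mat p \<in> carrier_mat p p"
  by (simp add: fourier_mat_def)

lemma mat_adjoint_fourier_mat_index:
  assumes "i < p" "j < p"
  shows "mat_adjoint (fourier_mat p) $$ (i, j) = cnj (fourier_root p) ^ (i * j) / of_real (sqrt (of_nat p))"
proof -
  have "mat_adjoint (fourier_mat p) $$ (i, j) = conjugate (fourier_mat p $$ (j, i))"
    using assms fourier_mat_carrier[of p] by (simp add: mat_adjoint_def mat_of_rows_index)
  then show ?thesis using assms by (simp add: fourier_mat_index mult.commute)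
qed

lemma mat_adjoint_fourier_mat_carrier: "mat_adjoint (fourier_mat p) \<in> carrier_mat p p"
  by (rule carrier_matI) (simp_all add: mat_adjoint_def fourier_mat_def)

section \<open>Entries and injectivity of the Fourier block diagonalization\<close>

lemma diag_block_mat_carrier:
  assumes "set Ds \<subseteq> carrier_mat m n"
  shows "diag_block_mat Ds \<in> carrier_mat (m * length Ds) (n * length Ds)"
  using assms by (induction Ds) (auto simp: Let_def)

text \<open>Induction on the list of blocks: subtracting the size of the first block lowers both
  quotients by one and keeps the remainders.\<close>

lemma diag_block_mat_index:
  assumes "set Ds \<subseteq> carrier_mat m n" "i < m * length Ds" "j < n * length Ds"
  shows "diag_block_mat Ds $$ (i, j) =
    (if i div m = j div n then (Ds ! (i div m)) $$ (i mod m, j mod n) else 0)"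
  using assms
proof (induction Ds arbitrary: i j)
  case (Cons D Ds)
  have D: "D \<in> carrier_mat m n" "set Ds \<subseteq> carrier_mat m n" using Cons.prems by auto
  have mn: "0 < m" "0 < n" using Cons.prems by (auto intro: gr0I)
  note c = diag_block_mat_carrier[OF D(2)]
  show ?case
  proof (cases "i < m \<or> j < n")
    case True
    then show ?thesis using Cons.prems c D mn
      by (auto simp: Let_def div_eq_0_iff)
  next
    case False
    then have "i div m = Suc ((i - m) div m)" "j div n = Suc ((j - n) div n)"
      "i mod m = (i - m) mod m" "j mod n = (j - n) mod n"
      using mn by (auto simp: le_div_geq le_mod_geq)
    then show ?thesis using Cons.prems c D mn False Cons.IH[of "i - m" "j - n"]
      by (auto simp: Let_def)
  qed
qed auto

lemma kron_one_index:
  assumes "F \<in> carrier_mat p r" "i < m * p" "j < m * r"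
  shows "kron F (1\<^sub>m m) $$ (i, j) = (if i mod m = j mod m then F $$ (i div m, j div m) else (0 :: 'a::semiring_1))"
  using assms by (auto simp: kron_def block_index_divmod mult.commute)

lemma kron_carrier:
  assumes "A \<in> carrier_mat a b" "B \<in> carrier_mat c d"
  shows "kron A B \<in> carrier_mat (a * c) (b * d)"
  using assms by (auto simp: kron_def)

lemma fourier_block_diag_carrier:
  assumes "set Ds \<subseteq> carrier_mat m n" "length Ds = p"
  shows "fourier_block_diag m n Ds \<in> carrier_mat (m * p) (n * p)"
  using kron_carrier[OF mat_adjoint_fourier_mat_carrier one_carrier_mat, of p m]
    kron_carrier[OF fourier_mat_carrier one_carrier_mat, of p n]
    diag_block_mat_carrier[OF assms(1)] assms(2)
  by (auto simp: fourier_block_diag_def mult.commute)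

text \<open>The Kronecker factors with an identity preserve the position inside a block and the
  middle factor preserves the block. What is left is the inverse discrete Fourier transform, at
  \<open>i div m - j div n\<close>, of one fixed entry of the blocks; the two square roots combine
  to the divisor \<open>p\<close>.\<close>

lemma fourier_block_diag_index:
  assumes Ds: "set Ds \<subseteq> carrier_mat m n" "length Ds = p" and ij: "i < m * p" "j < n * p"
  shows "fourier_block_diag m n Ds $$ (i, j) =
    (\<Sum>l<p. cnj (fourier_root p) ^ ((i div m) * l) * fourier_root p ^ (l * (j div n)) *
       (Ds ! l) $$ (i mod m, j mod n)) / of_nat p"
proof -
  let ?L = "kron (mat_adjoint (fourier_mat p)) (1\<^sub>m m)" and ?R = "kron (fourier_mat p) (1\<^sub>m n)"
  let ?D = "diag_block_mat Ds"
  let ?F = "fourier_mat p" and ?G = "mat_adjoint (fourier_mat p)"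
  note dm = block_index_divmod[OF ij(1)] block_index_divmod[OF ij(2)]
  have L: "?L \<in> carrier_mat (m * p) (m * p)" and R: "?R \<in> carrier_mat (n * p) (n * p)"
    and D: "?D \<in> carrier_mat (m * p) (n * p)"
    using kron_carrier[OF mat_adjoint_fourier_mat_carrier one_carrier_mat, of p m]
      kron_carrier[OF fourier_mat_carrier one_carrier_mat, of p n] diag_block_mat_carrier[OF Ds(1)] Ds(2)
    by (simp_all add: mult.commute)
  \<comment> \<open>One term of the sum over \<open>r\<close> survives: \<open>?D\<close> forces the
    block \<open>c div n\<close> and \<open>?L\<close> forces the position
    \<open>i mod m\<close>.\<close>
  have LD: "(?L * ?D) $$ (i, c) = ?G $$ (i div m, c div n) * (Ds ! (c div n)) $$ (i mod m, c mod n)"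
    if c: "c < n * p" for c
  proof -
    have "(?L * ?D) $$ (i, c) = (\<Sum>r<m * p. ?L $$ (i, r) * ?D $$ (r, c))"
      using L D ij c by (simp add: scalar_prod_def lessThan_atLeast0)
    also have "\<dots> = (\<Sum>r<m * p. (if r div m = c div n then if r mod m = i mod m then
        ?G $$ (i div m, r div m) * (Ds ! (r div m)) $$ (r mod m, c mod n) else 0 else 0))"
      using ij c Ds
      by (intro sum.cong refl)
        (auto simp: kron_one_index[OF mat_adjoint_fourier_mat_carrier] diag_block_mat_index[OF Ds(1)])
    also have "\<dots> = (\<Sum>l<p. \<Sum>a<m. (if l = c div n then if a = i mod m then
        ?G $$ (i div m, l) * (Ds ! l) $$ (a, c mod n) else 0 else 0))"
      by (rule sum_div_mod)
    also have "\<dots> = (\<Sum>l<p. if l = c div n then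
        \<Sum>a<m. (if a = i mod m then ?G $$ (i div m, l) * (Ds ! l) $$ (a, c mod n) else 0) else 0)"
      by (intro sum.cong refl) auto
    also have "\<dots> = ?G $$ (i div m, c div n) * (Ds ! (c div n)) $$ (i mod m, c mod n)"
      using dm block_index_divmod[OF c] by (simp add: sum.delta)
    finally show ?thesis .
  qed
  have "fourier_block_diag m n Ds $$ (i, j) = (\<Sum>c<n * p. (?L * ?D) $$ (i, c) * ?R $$ (c, j))"
    unfolding fourier_block_diag_def Ds(2) by (rule mat_mult_index[OF mult_carrier_mat[OF L D] R ij])
  also have "\<dots> = (\<Sum>c<n * p. if c mod n = j mod n then
      ?G $$ (i div m, c div n) * (Ds ! (c div n)) $$ (i mod m, c mod n) * ?F $$ (c div n, j div n) else 0)"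
    using ij by (intro sum.cong refl) (auto simp: LD kron_one_index[OF fourier_mat_carrier])
  also have "\<dots> = (\<Sum>l<p. \<Sum>b<n. if b = j mod n then
      ?G $$ (i div m, l) * (Ds ! l) $$ (i mod m, b) * ?F $$ (l, j div n) else 0)"
    by (rule sum_div_mod)
  also have "\<dots> = (\<Sum>l<p. ?G $$ (i div m, l) * (Ds ! l) $$ (i mod m, j mod n) * ?F $$ (l, j div n))"
    using dm by (simp add: sum.delta)
  also have "\<dots> = (\<Sum>l<p. (cnj (fourier_root p) ^ ((i div m) * l) * fourier_root p ^ (l * (j div n)) *
       (Ds ! l) $$ (i mod m, j mod n)) / (of_real (sqrt (of_nat p)) * of_real (sqrt (of_nat p))))"
    using dm by (intro sum.cong refl)
      (simp add: fourier_mat_index mat_adjoint_fourier_mat_index mult_ac del: of_real_sqrt)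
  also have "of_real (sqrt (of_nat p)) * of_real (sqrt (of_nat p)) = (of_nat p :: complex)"
    by (simp flip: of_real_mult)
  finally show ?thesis by (simp add: sum_divide_distrib)
qed

text \<open>Fourier inversion recovers each block from the first block column of the product. This
  is the uniqueness that the definite description in \<open>fourier_blocks\<close> requires.\<close>

lemma fourier_block_diag_inj:
  assumes Ds: "set Ds \<subseteq> carrier_mat m n" "length Ds = p"
    and Es: "set Es \<subseteq> carrier_mat m n" "length Es = p"
    and eq: "fourier_block_diag m n Ds = fourier_block_diag m n Es"
  shows "Ds = Es"
proof (rule nth_equalityI)
  fix k assume "k < length Ds"
  then have k: "k < p" using Ds by simp
  have carr: "Ds ! k \<in> carrier_mat m n" "Es ! k \<in> carrier_mat m n"
    using subsetD[OF Ds(1) nth_mem] subsetD[OF Es(1) nth_mem] k Ds(2) Es(2) by simp_all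
  have "(Ds ! k) $$ (a, b) = (Es ! k) $$ (a, b)" if ab: "a < m" "b < n" for a b
  proof -
    \<comment> \<open>Fourier inversion: after exchanging the sums, orthogonality keeps only
      \<open>l = k\<close>.\<close>
    have inv: "(\<Sum>i<p. fourier_root p ^ (k * i) * (\<Sum>l<p. cnj (fourier_root p) ^ (i * l) * d l)) = of_nat p * d k"
      for d
    proof -
      have "(\<Sum>i<p. fourier_root p ^ (k * i) * (\<Sum>l<p. cnj (fourier_root p) ^ (i * l) * d l)) =
          (\<Sum>l<p. d l * (\<Sum>i<p. cnj (fourier_root p) ^ (l * i) * fourier_root p ^ (k * i)))"
        unfolding sum_distrib_left by (subst sum.swap) (simp only: mult_ac)
      also have "\<dots> = (\<Sum>l<p. if l = k then d l * of_nat p else 0)"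
        using k by (intro sum.cong refl) (simp only: fourier_root_orthogonal lessThan_iff, simp)
      finally show ?thesis using k by simp
    qed
    \<comment> \<open>The column \<open>b\<close> lies in block column 0, where the factor
      \<open>fourier_root p ^ (l * 0)\<close> is 1.\<close>
    have eqs: "(\<Sum>l<p. cnj (fourier_root p) ^ (i * l) * (Ds ! l) $$ (a, b)) =
        (\<Sum>l<p. cnj (fourier_root p) ^ (i * l) * (Es ! l) $$ (a, b))" if i: "i < p" for i
    proof -
      have ia: "i * m + a < m * p" and b: "b < n * p"
        using block_index_less[OF i ab(1)] block_index_less[of 0 p b n] k ab by auto
      show ?thesis
        using arg_cong[OF eq, of "\<lambda>M. M $$ (i * m + a, b)"] ab k
          fourier_block_diag_index[OF Ds ia b] fourier_block_diag_index[OF Es ia b]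
        by simp
    qed
    have "(\<Sum>i<p. fourier_root p ^ (k * i) * (\<Sum>l<p. cnj (fourier_root p) ^ (i * l) * (Ds ! l) $$ (a, b))) =
        (\<Sum>i<p. fourier_root p ^ (k * i) * (\<Sum>l<p. cnj (fourier_root p) ^ (i * l) * (Es ! l) $$ (a, b)))"
      by (intro sum.cong refl) (simp only: eqs lessThan_iff)
    then have "of_nat p * (Ds ! k) $$ (a, b) = of_nat p * (Es ! k) $$ (a, b)"
      unfolding inv .
    then show ?thesis using k by simp
  qed
  then show "Ds ! k = Es ! k" using carr by (intro eq_matI) auto
qed (use Ds Es in simp)

text \<open>The unnormalised discrete Fourier transform along the slices, taken separately at each
  matrix position: the explicit candidate for the blocks described in
  \<open>fourier_blocks\<close>.\<close>

definition dft_blocks :: "tensor \<Rightarrow> complex mat list" where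
  "dft_blocks A = map (\<lambda>l. mat (t_rows A) (t_cols A)
     (\<lambda>(a, b). \<Sum>k<length A. fourier_root (length A) ^ (l * k) * of_real ((A ! k) $$ (a, b)))) [0..<length A]"

lemma dft_blocks_carrier:
  assumes "A \<in> tensor_space m n p" "0 < p"
  shows "set (dft_blocks A) \<subseteq> carrier_mat m n" "length (dft_blocks A) = p"
  using tensor_spaceD[OF assms(1)] assms(2) by (auto simp: dft_blocks_def)

lemma dft_blocks_index:
  assumes "A \<in> tensor_space m n p" "l < p" "a < m" "b < n"
  shows "(dft_blocks A ! l) $$ (a, b) = (\<Sum>k<p. fourier_root p ^ (l * k) * of_real ((A ! k) $$ (a, b)))"
  using tensor_spaceD[OF assms(1)] assms(2-) by (auto simp: dft_blocks_def)

text \<open>Existence of the block diagonalization. Inserting the transform into the entry formula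
  and exchanging sums leaves an orthogonality sum that selects the slice \<open>k\<close> with
  \<open>J + k = I\<close> modulo \<open>p\<close>, the slice standing in block
  \<open>(I, J)\<close>.\<close>

lemma bcirc_eq_fourier_block_diag:
  assumes A: "A \<in> tensor_space m n p" and p: "0 < p"
  shows "map_mat complex_of_real (bcirc A) = fourier_block_diag m n (dft_blocks A)"
proof (rule eq_matI)
  note Ds = dft_blocks_carrier[OF A p]
  note c = fourier_block_diag_carrier[OF Ds]
  fix i j assume "i < dim_row (fourier_block_diag m n (dft_blocks A))"
    "j < dim_col (fourier_block_diag m n (dft_blocks A))"
  then have ij: "i < m * p" "j < n * p" using c by auto
  note dm = block_index_divmod[OF ij(1)] block_index_divmod[OF ij(2)]
  define I J where "I = i div m" and "J = j div n"
  have IJ: "I < p" "J < p" using dm by (auto simp: I_def J_def)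
  define a where "a k = complex_of_real ((A ! k) $$ (i mod m, j mod n))" for k
  have "fourier_block_diag m n (dft_blocks A) $$ (i, j) =
      (\<Sum>l<p. cnj (fourier_root p) ^ (I * l) * fourier_root p ^ (l * J) * (\<Sum>k<p. fourier_root p ^ (l * k) * a k)) / of_nat p"
    unfolding fourier_block_diag_index[OF Ds ij] I_def J_def a_def
    using dm by (simp add: dft_blocks_index[OF A])
  also have "(\<Sum>l<p. cnj (fourier_root p) ^ (I * l) * fourier_root p ^ (l * J) * (\<Sum>k<p. fourier_root p ^ (l * k) * a k)) =
      (\<Sum>k<p. a k * (\<Sum>l<p. cnj (fourier_root p) ^ (I * l) * fourier_root p ^ ((J + k) * l)))"
    unfolding sum_distrib_left
    by (subst sum.swap) (simp only: mult_ac power_add distrib_left distrib_right)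
  \<comment> \<open>\<open>J + k\<close> may exceed \<open>p - 1\<close>, while orthogonality is
    stated for indices below \<open>p\<close>; the reduction is harmless since the root has period
    \<open>p\<close>.\<close>
  also have "\<dots> = (\<Sum>k<p. a k * (\<Sum>l<p. cnj (fourier_root p) ^ (I * l) * fourier_root p ^ (((J + k) mod p) * l)))"
    by (simp only: power_mult fourier_root_power_mod[OF p])
  also have "\<dots> = (\<Sum>k<p. if k = (I + p - J) mod p then a k * of_nat p else 0)"
  proof (intro sum.cong refl)
    fix k assume "k \<in> {..<p}"
    then have "I = (J + k) mod p \<longleftrightarrow> k = (I + p - J) mod p"
      using IJ by (auto simp: mod_diff_eq mod_if)
    then show "a k * (\<Sum>l<p. cnj (fourier_root p) ^ (I * l) * fourier_root p ^ (((J + k) mod p) * l)) =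
        (if k = (I + p - J) mod p then a k * of_nat p else 0)"
      using fourier_root_orthogonal[OF IJ(1), of "(J + k) mod p"] p by (simp only: mod_less_divisor) simp
  qed
  also have "\<dots> = a ((I + p - J) mod p) * of_nat p" using p by (simp add: sum.delta)
  finally have "fourier_block_diag m n (dft_blocks A) $$ (i, j) = a ((I + p - J) mod p)" using p by simp
  then show "map_mat complex_of_real (bcirc A) $$ (i, j) = fourier_block_diag m n (dft_blocks A) $$ (i, j)"
    using ij bcirc_carrier[OF A p] by (simp add: bcirc_index[OF A p ij] a_def I_def J_def)
qed (use fourier_block_diag_carrier[OF dft_blocks_carrier[OF A p]] bcirc_carrier[OF A p] in auto)

section \<open>Evaluating the definite descriptions in the Kronecker product\<close>

lemma fourier_blocks_eq:
  assumes A: "A \<in> tensor_space m n p" and p: "0 < p"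
  shows "fourier_blocks A = dft_blocks A"
  unfolding fourier_blocks_def Let_def tensor_spaceD(1)[OF A] tensor_spaceD(5,6)[OF A p]
proof (rule the_equality)
  note Ds = dft_blocks_carrier[OF A p]
  show "length (dft_blocks A) = p \<and> set (dft_blocks A) \<subseteq> carrier_mat m n \<and>
      map_mat complex_of_real (bcirc A) = fourier_block_diag m n (dft_blocks A)"
    using Ds bcirc_eq_fourier_block_diag[OF A p] by blast
  fix Es assume Es: "length Es = p \<and> set Es \<subseteq> carrier_mat m n \<and>
      map_mat complex_of_real (bcirc A) = fourier_block_diag m n Es"
  then have "fourier_block_diag m n Es = fourier_block_diag m n (dft_blocks A)"
    using bcirc_eq_fourier_block_diag[OF A p] by argo
  with Es show "Es = dft_blocks A"
    using fourier_block_diag_inj[OF _ _ Ds] by blast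
qed

lemma bcirc_inv_bcirc:
  assumes A: "A \<in> tensor_space m n p" and p: "0 < p"
  shows "bcirc_inv m n p (map_mat complex_of_real (bcirc A)) = A"
  unfolding bcirc_inv_def
proof (rule the_equality)
  fix C assume C: "C \<in> tensor_space m n p \<and> map_mat complex_of_real (bcirc C) = map_mat complex_of_real (bcirc A)"
  then have "bcirc C = bcirc A" by (auto simp: of_real_hom.mat_hom_inj)
  then show "C = A" using C bcirc_inj[OF _ A p] by blast
qed (use A in simp)

text \<open>Only slice 0 of \<open>tid n p\<close> is nonzero, so each of its Fourier blocks is the
  identity matrix. The Kronecker product with the one-by-one block of \<open>c\<close> is then that
  scalar times the identity, which is the corresponding block of
  \<open>tube_diag n c\<close>.\<close>

lemma tkron_tid:
  assumes c: "c \<in> tensor_space 1 1 p" and p: "0 < p"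
  shows "c \<otimes>\<^sub>t tid n p = tube_diag n c"
proof -
  note I = tid_space[of n p]
  have D: "tube_diag n c \<in> tensor_space n n p" using tensor_spaceD(1)[OF c] by (rule tube_diag_space)
  have "map2 kron (dft_blocks c) (dft_blocks (tid n p)) = dft_blocks (tube_diag n c)"
  proof (rule nth_equalityI)
    fix l assume "l < length (map2 kron (dft_blocks c) (dft_blocks (tid n p)))"
    then have l: "l < p" using dft_blocks_carrier[OF c p] dft_blocks_carrier[OF I p] by simp
    have carr: "dft_blocks c ! l \<in> carrier_mat 1 1" "dft_blocks (tid n p) ! l \<in> carrier_mat n n"
      "dft_blocks (tube_diag n c) ! l \<in> carrier_mat n n"
      using subsetD[OF dft_blocks_carrier(1)[OF c p] nth_mem] subsetD[OF dft_blocks_carrier(1)[OF I p] nth_mem]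
        subsetD[OF dft_blocks_carrier(1)[OF D p] nth_mem] l
      by (simp_all add: dft_blocks_carrier(2)[OF c p] dft_blocks_carrier(2)[OF I p] dft_blocks_carrier(2)[OF D p])
    have "kron (dft_blocks c ! l) (dft_blocks (tid n p) ! l) = dft_blocks (tube_diag n c) ! l"
    proof (rule eq_matI)
      fix a b assume "a < dim_row (dft_blocks (tube_diag n c) ! l)" "b < dim_col (dft_blocks (tube_diag n c) ! l)"
      then have ab: "a < n" "b < n" using carr by auto
      have "(dft_blocks (tid n p) ! l) $$ (a, b) = (\<Sum>k<p. if k = 0 then if a = b then 1 else 0 else 0)"
        unfolding dft_blocks_index[OF I l ab] using ab by (intro sum.cong refl) (auto simp: tid_index)
      also have "\<dots> = (if a = b then 1 else 0)" using p by (simp add: sum.delta)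
      finally have "kron (dft_blocks c ! l) (dft_blocks (tid n p) ! l) $$ (a, b) =
          (dft_blocks c ! l) $$ (0, 0) * (if a = b then 1 else 0)"
        using carr ab by (simp add: kron_def)
      also have "\<dots> = (dft_blocks (tube_diag n c) ! l) $$ (a, b)"
        unfolding dft_blocks_index[OF D l ab] dft_blocks_index[OF c l less_one[THEN iffD2, OF refl] less_one[THEN iffD2, OF refl]]
        using tensor_spaceD(1)[OF c] ab by (auto simp: tube_diag_index)
      finally show "kron (dft_blocks c ! l) (dft_blocks (tid n p) ! l) $$ (a, b) =
          (dft_blocks (tube_diag n c) ! l) $$ (a, b)" .
    qed (use carr kron_carrier[OF carr(1,2)] in auto)
    then show "map2 kron (dft_blocks c) (dft_blocks (tid n p)) ! l = dft_blocks (tube_diag n c) ! l"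
      using l dft_blocks_carrier[OF c p] dft_blocks_carrier[OF I p] by simp
  qed (use dft_blocks_carrier[OF c p] dft_blocks_carrier[OF I p] dft_blocks_carrier[OF D p] in simp)
  then show ?thesis
    using bcirc_inv_bcirc[OF D p] tensor_spaceD[OF c] tensor_spaceD[OF I] p
    by (simp add: tkron_def Let_def fourier_blocks_eq[OF c p] fourier_blocks_eq[OF I p]
        bcirc_eq_fourier_block_diag[OF D p])
qed

subsection \<open>The stationarity conditions as an eigenvalue problem\<close>

lemma ttranspose_tadd:
  assumes A: "A \<in> tensor_space m n p" and B: "B \<in> tensor_space m n p"
  shows "(A \<oplus>\<^sub>t B)\<^sup>\<top> = A\<^sup>\<top> \<oplus>\<^sub>t B\<^sup>\<top>"
  by (rule tensor_eqI[OF ttranspose_space[OF tadd_space[OF A B]] tadd_space[OF ttranspose_space[OF A] ttranspose_space[OF B]]])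
    (simp add: ttranspose_index[OF tadd_space[OF A B]] tadd_index[OF ttranspose_space[OF A] ttranspose_space[OF B]]
      ttranspose_index[OF A] ttranspose_index[OF B] tadd_index[OF A B])

lemma ttranspose_tsmult:
  assumes A: "A \<in> tensor_space m n p"
  shows "(c \<cdot>\<^sub>t A)\<^sup>\<top> = c \<cdot>\<^sub>t A\<^sup>\<top>"
  by (rule tensor_eqI[OF ttranspose_space[OF tsmult_space[OF A]] tsmult_space[OF ttranspose_space[OF A]]])
    (simp add: ttranspose_index[OF tsmult_space[OF A]] tsmult_index[OF ttranspose_space[OF A]]
      ttranspose_index[OF A] tsmult_index[OF A])

section \<open>Unfolding of differences and products of stacked matrices\<close>

lemma unfold_tminus:
  assumes A: "A \<in> tensor_space m n p" and B: "B \<in> tensor_space m n p" and p: "0 < p"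
  shows "unfold (A \<ominus>\<^sub>t B) = unfold A - unfold B"
proof -
  note AB = tminus_space[OF A B]
  show ?thesis
    using unfold_carrier[OF A p] unfold_carrier[OF B p] unfold_carrier[OF AB p]
    by (intro eq_matI)
      (auto simp: unfold_index[OF A p] unfold_index[OF B p] unfold_index[OF AB p] tminus_index[OF A B] block_index_divmod)
qed

lemma unfold_tuminus:
  assumes A: "A \<in> tensor_space m n p" and p: "0 < p"
  shows "unfold (tuminus A) = - unfold A"
proof -
  note A' = tuminus_space[OF A]
  show ?thesis
    using unfold_carrier[OF A p] unfold_carrier[OF A' p]
    by (intro eq_matI)
      (auto simp: unfold_index[OF A p] unfold_index[OF A' p] tuminus_index[OF A] block_index_divmod)
qed

text \<open>\<open>x @\<^sub>r y\<close> is a block matrix whose right-hand blocks have width 0, so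
  block multiplication covers it.\<close>

lemma four_block_mat_mult_append_rows:
  fixes A :: "'a::semiring_0 mat"
  assumes "A \<in> carrier_mat a b" "B \<in> carrier_mat a c" "C \<in> carrier_mat d b" "D \<in> carrier_mat d c"
    and "x \<in> carrier_mat b k" "y \<in> carrier_mat c k"
  shows "four_block_mat A B C D * (x @\<^sub>r y) = (A * x + B * y) @\<^sub>r (C * x + D * y)"
proof -
  have "x @\<^sub>r y = four_block_mat x (0\<^sub>m b 0) y (0\<^sub>m c 0)"
    using assms by (auto simp: append_rows_def)
  then show ?thesis
    using mult_four_block_mat[OF assms(1-5) _ assms(6), of "0\<^sub>m b 0" 0 "0\<^sub>m c 0"] assms
    by (auto simp: append_rows_def intro!: cong_four_block_mat eq_matI)
qed

lemma uminus_append_rows: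
  fixes A :: "'a::group_add mat"
  assumes "A \<in> carrier_mat a k" "B \<in> carrier_mat b k"
  shows "- (A @\<^sub>r B) = (- A) @\<^sub>r (- B)"
  using assms by (intro eq_matI) (auto simp: append_rows_def)

text \<open>The two block rows of the eigenvalue equation before unfolding, with
  \<open>tube_diag\<close> in place of the Kronecker products. The lower block of the vector is
  negative, so the second column of blocks is subtracted and the second right-hand side is
  \<open>lamI\<close> with a positive sign.\<close>

lemma trtls_stationarity_rows:
  fixes R lamI lamK :: tensor
  assumes p: "0 < p"
    and A: "A \<in> tensor_space m n p" and B: "B \<in> tensor_space m 1 p" and K: "K \<in> tensor_space q n p"
    and At: "At \<in> tensor_space m n p" and X: "X \<in> tensor_space n 1 p"
    and mult: "trtls_multiplier A B K \<delta> At X \<mu>"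
  defines "R \<equiv> B \<ominus>\<^sub>t At \<star> X"
    and "lamI \<equiv> \<mu> \<cdot>\<^sub>t (X\<^sup>\<top> \<star> K\<^sup>\<top> \<star> K \<star> X) \<ominus>\<^sub>t R\<^sup>\<top> \<star> R \<star> X\<^sup>\<top> \<star> X \<ominus>\<^sub>t R\<^sup>\<top> \<star> B"
    and "lamK \<equiv> \<mu> \<cdot>\<^sub>t (tid 1 p \<oplus>\<^sub>t X\<^sup>\<top> \<star> X)"
  shows "(A\<^sup>\<top> \<star> A \<oplus>\<^sub>t K\<^sup>\<top> \<star> K \<star> tube_diag n lamK) \<star> X \<ominus>\<^sub>t A\<^sup>\<top> \<star> B = tuminus (tube_diag n lamI \<star> X)"
    and "(A\<^sup>\<top> \<star> B)\<^sup>\<top> \<star> X \<ominus>\<^sub>t (tuminus lamK \<star> X\<^sup>\<top> \<star> K\<^sup>\<top> \<star> K \<star> X \<oplus>\<^sub>t B\<^sup>\<top> \<star> B) = lamI"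
    and "lamI \<in> tensor_space 1 1 p" "lamK \<in> tensor_space 1 1 p"
proof -
  note ps = tprod_space[OF p]
  note AT = ttranspose_space[OF A] and BT = ttranspose_space[OF B] and KT = ttranspose_space[OF K]
    and XT = ttranspose_space[OF X] and AtT = ttranspose_space[OF At]
  note AX = ps[OF A X] and AtX = ps[OF At X] and KX = ps[OF K X]
  have R: "R \<in> tensor_space m 1 p" unfolding R_def by (rule tminus_space[OF B AtX])
  note RT = ttranspose_space[OF R] and one = tid_space[of 1 p]
  \<comment> \<open>Both rows reduce to products of these tensors. \<open>T\<close>,
    \<open>W\<close>, \<open>Q\<close> and \<open>c\<close> are tubes, and \<open>g\<close> is half
    the gradient of the squared norm of \<open>K \<star> X\<close>.\<close>
  define T where "T = X\<^sup>\<top> \<star> X"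
  define W where "W = tid 1 p \<oplus>\<^sub>t T"
  define Q where "Q = R\<^sup>\<top> \<star> R"
  define g where "g = K\<^sup>\<top> \<star> (K \<star> X)"
  define c where "c = X\<^sup>\<top> \<star> g"
  have T: "T \<in> tensor_space 1 1 p" unfolding T_def by (rule ps[OF XT X])
  have W: "W \<in> tensor_space 1 1 p" unfolding W_def by (rule tadd_space[OF one T])
  have Q: "Q \<in> tensor_space 1 1 p" unfolding Q_def by (rule ps[OF RT R])
  have g: "g \<in> tensor_space n 1 p" unfolding g_def by (rule ps[OF KT KX])
  have c: "c \<in> tensor_space 1 1 p" unfolding c_def by (rule ps[OF XT g])
  have lamK_W: "lamK = \<mu> \<cdot>\<^sub>t W" by (simp add: lamK_def W_def T_def)
  show lamK: "lamK \<in> tensor_space 1 1 p" unfolding lamK_W by (rule tsmult_space[OF W])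
  note QT = ps[OF Q T] and QW = ps[OF Q W] and RW = ps[OF R W] and RTens = ps[OF R T] and BR = ps[OF BT R]
    and cW = ps[OF c W] and gW = ps[OF g W] and XQ = ps[OF X Q] and RTB = ps[OF RT B]
    and AR = ps[OF AT R] and BRW = ps[OF ps[OF BT R] W] and XQW = ps[OF X ps[OF Q W]]
    and BTB = ps[OF BT B] and ATB = ps[OF AT B] and lKc = ps[OF lamK c]
  note mem = A B K At X AT BT KT XT AX AtX R T W Q g c QT QW RW RTens BR cW gW XQ RTB AR BRW XQW BTB ATB lKc
    tadd_space tminus_space tsmult_space tuminus_space
  \<comment> \<open>With these rules a linear identity between tensors is checked entry by entry,
    the T-products in it being treated as atoms.\<close>
  note ix = tadd_index[where p = p] tminus_index[where p = p] tsmult_index[where p = p] tuminus_index[where p = p]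
  note ixm = ix[where m = m and n = 1] and ixn = ix[where m = n and n = 1]
    and ix1 = ix[where m = 1 and n = 1]

  \<comment> \<open>\<open>\<star>\<close> associates to the left, so the products must be regrouped
    before \<open>c\<close> and \<open>Q \<star> T\<close> appear.\<close>
  have lamI_eq: "lamI = \<mu> \<cdot>\<^sub>t c \<ominus>\<^sub>t Q \<star> T \<ominus>\<^sub>t R\<^sup>\<top> \<star> B"
    by (simp add: lamI_def c_def g_def Q_def T_def tprod_assoc[OF p XT KT K]
        tprod_assoc[OF p XT ps[OF KT K] X] tprod_assoc[OF p KT K X] tprod_assoc[OF p ps[OF RT R] XT X])
  show lamI: "lamI \<in> tensor_space 1 1 p"
    unfolding lamI_eq by (intro tminus_space tsmult_space c QT RTB)

  have At_eq: "At = A \<oplus>\<^sub>t R \<star> X\<^sup>\<top>"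
    unfolding R_def by (rule trtls_multiplier_At[OF A B p At X mult])
  have AtR: "At\<^sup>\<top> \<star> R = \<mu> \<cdot>\<^sub>t g"
    unfolding R_def g_def by (rule trtls_multiplier_X[OF A B p K At X mult])

  have RW_eq: "R \<star> W = R \<oplus>\<^sub>t R \<star> T"
    unfolding W_def tprod_tadd_right[OF p R one T] tprod_tid_right[OF p R] ..
  have "At \<star> X = A \<star> X \<oplus>\<^sub>t R \<star> T"
    by (subst At_eq) (simp only: tprod_tadd_left[OF p A ps[OF R XT] X] tprod_assoc[OF p R XT X] T_def)
  \<comment> \<open>Substituting \<open>At \<star> X\<close> by \<open>B\<close> minus
    \<open>R\<close> gives \<open>B\<close> minus \<open>R\<close> minus \<open>R \<star> T\<close>,
    and the last two terms form \<open>R \<star> W\<close>.\<close>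
  then have AX_eq: "A \<star> X = B \<ominus>\<^sub>t R \<star> W"
    unfolding RW_eq
    by (intro tensor_eqI[OF AX]) (simp_all add: mem ixm tminus_index[OF B AtX, folded R_def] del: One_nat_def)

  have "At\<^sup>\<top> = A\<^sup>\<top> \<oplus>\<^sub>t X \<star> R\<^sup>\<top>"
    by (subst At_eq) (simp only: ttranspose_tadd[OF A ps[OF R XT]] ttranspose_tprod[OF p R XT] ttranspose_ttranspose[OF X])
  then have "At\<^sup>\<top> \<star> R = A\<^sup>\<top> \<star> R \<oplus>\<^sub>t X \<star> Q"
    by (simp only: tprod_tadd_left[OF p AT ps[OF X RT] R] tprod_assoc[OF p X RT R] Q_def)
  then have "\<mu> \<cdot>\<^sub>t g = A\<^sup>\<top> \<star> R \<oplus>\<^sub>t X \<star> Q" using AtR by simp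
  then have AR_eq: "A\<^sup>\<top> \<star> R = \<mu> \<cdot>\<^sub>t g \<ominus>\<^sub>t X \<star> Q"
    by (intro tensor_eqI[OF AR]) (simp_all add: mem ixn del: One_nat_def)

  \<comment> \<open>\<open>B\<close> splits into the fitted part \<open>At \<star> X\<close> and the
    residual \<open>R\<close>. Paired with \<open>R\<close>, the first contributes
    \<open>\<mu> \<cdot>\<^sub>t c\<close> by stationarity in \<open>X\<close> and the second
    contributes \<open>Q\<close>.\<close>
  have BTR: "B\<^sup>\<top> \<star> R = \<mu> \<cdot>\<^sub>t c \<oplus>\<^sub>t Q"
  proof -
    have "B = At \<star> X \<oplus>\<^sub>t R"
      unfolding R_def by (intro tensor_eqI[OF B]) (simp_all add: mem ixm del: One_nat_def)
    then have "B\<^sup>\<top> \<star> R = (At \<star> X)\<^sup>\<top> \<star> R \<oplus>\<^sub>t R\<^sup>\<top> \<star> R"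
      using ttranspose_tadd[OF AtX R] tprod_tadd_left[OF p ttranspose_space[OF AtX] RT R] by simp
    also have "(At \<star> X)\<^sup>\<top> \<star> R = X\<^sup>\<top> \<star> (At\<^sup>\<top> \<star> R)"
      unfolding ttranspose_tprod[OF p At X] by (rule tprod_assoc[OF p XT AtT R])
    also have "\<dots> = \<mu> \<cdot>\<^sub>t c"
      unfolding AtR tprod_tsmult_right[OF p XT g] c_def ..
    finally show ?thesis unfolding Q_def .
  qed
  \<comment> \<open>\<open>c\<close> and \<open>Q\<close> are Gram tubes of
    \<open>K \<star> X\<close> and \<open>R\<close>, hence symmetric; therefore so is
    \<open>B\<^sup>\<top> \<star> R\<close>, which may replace its transpose in
    \<open>lamI\<close>.\<close>
  have "c\<^sup>\<top> = c"
  proof -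
    have "c = (K \<star> X)\<^sup>\<top> \<star> (K \<star> X)"
      unfolding c_def g_def ttranspose_tprod[OF p K X] by (rule tprod_assoc[OF p XT KT KX, symmetric])
    then show ?thesis
      using ttranspose_tprod[OF p ttranspose_space[OF KX] KX] ttranspose_ttranspose[OF KX] by simp
  qed
  moreover have "Q\<^sup>\<top> = Q"
    unfolding Q_def ttranspose_tprod[OF p RT R] ttranspose_ttranspose[OF R] ..
  ultimately have "(B\<^sup>\<top> \<star> R)\<^sup>\<top> = B\<^sup>\<top> \<star> R"
    unfolding BTR ttranspose_tadd[OF tsmult_space[OF c] Q] ttranspose_tsmult[OF c] by simp
  then have RTB_eq: "R\<^sup>\<top> \<star> B = B\<^sup>\<top> \<star> R"
    unfolding ttranspose_tprod[OF p BT R] ttranspose_ttranspose[OF B] .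

  have "Q \<star> W = Q \<oplus>\<^sub>t Q \<star> T"
    unfolding W_def tprod_tadd_right[OF p Q one T] tprod_tid_right[OF p Q] ..
  \<comment> \<open>The multiples of \<open>c\<close> cancel, and \<open>Q\<close> with
    \<open>Q \<star> T\<close> makes up \<open>Q \<star> W\<close>.\<close>
  then have lamI_QW: "lamI = (- 1) \<cdot>\<^sub>t (Q \<star> W)"
    unfolding lamI_eq RTB_eq BTR by (intro tensor_eqI[where m = 1 and n = 1 and p = p]) (simp_all add: mem ix1 del: One_nat_def)

  note DK = tube_diag_space[OF tensor_spaceD(1)[OF lamK], of n]
    and DI = tube_diag_space[OF tensor_spaceD(1)[OF lamI], of n]
  show "(A\<^sup>\<top> \<star> A \<oplus>\<^sub>t K\<^sup>\<top> \<star> K \<star> tube_diag n lamK) \<star> X \<ominus>\<^sub>t A\<^sup>\<top> \<star> B = tuminus (tube_diag n lamI \<star> X)"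
  proof -
    have "(A\<^sup>\<top> \<star> A \<oplus>\<^sub>t K\<^sup>\<top> \<star> K \<star> tube_diag n lamK) \<star> X =
        A\<^sup>\<top> \<star> (A \<star> X) \<oplus>\<^sub>t K\<^sup>\<top> \<star> K \<star> (tube_diag n lamK \<star> X)"
      by (simp only: tprod_tadd_left[OF p ps[OF AT A] ps[OF ps[OF KT K] DK] X] tprod_assoc[OF p AT A X]
          tprod_assoc[OF p ps[OF KT K] DK X])
    \<comment> \<open>Moving the tube to the right of \<open>X\<close> exposes \<open>g\<close> as
      the left factor.\<close>
    also have "K\<^sup>\<top> \<star> K \<star> (tube_diag n lamK \<star> X) = \<mu> \<cdot>\<^sub>t (g \<star> W)"
      unfolding tube_diag_tprod[OF p lamK X] unfolding lamK_W g_def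
      by (simp only: tprod_tsmult_right[OF p X W] tprod_tsmult_right[OF p ps[OF KT K] ps[OF X W]]
        tprod_assoc[OF p KT K X, symmetric] tprod_assoc[OF p ps[OF KT K] X W])
    also have "A\<^sup>\<top> \<star> (A \<star> X) = A\<^sup>\<top> \<star> B \<ominus>\<^sub>t A\<^sup>\<top> \<star> R \<star> W"
      unfolding AX_eq tminus_eq_tadd[OF B RW] tminus_eq_tadd[OF ATB ps[OF AR W]]
      by (simp only: tprod_tadd_right[OF p AT B tsmult_space[OF RW]] tprod_tsmult_right[OF p AT RW] tprod_assoc[OF p AT R W])
    also have "A\<^sup>\<top> \<star> R \<star> W = \<mu> \<cdot>\<^sub>t (g \<star> W) \<ominus>\<^sub>t X \<star> (Q \<star> W)"
      unfolding AR_eq tminus_eq_tadd[OF tsmult_space[OF g] XQ] tminus_eq_tadd[OF tsmult_space[OF gW] XQW]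
      by (simp only: tprod_tadd_left[OF p tsmult_space[OF g] tsmult_space[OF XQ] W] tprod_tsmult_left[OF p g W]
          tprod_tsmult_left[OF p XQ W] tprod_assoc[OF p X Q W])
    also have "tube_diag n lamI \<star> X = (- 1) \<cdot>\<^sub>t (X \<star> (Q \<star> W))"
      unfolding tube_diag_tprod[OF p lamI X] unfolding lamI_QW by (rule tprod_tsmult_right[OF p X QW])
    \<comment> \<open>The terms with \<open>A\<^sup>\<top> \<star> B\<close> and with
      \<open>g \<star> W\<close> cancel; both sides are
      \<open>X \<star> (Q \<star> W)\<close>.\<close>
    ultimately show ?thesis
      by (intro tensor_eqI[where m = n and n = 1 and p = p]) (simp_all add: mem ixn del: One_nat_def)
  qed

  show "(A\<^sup>\<top> \<star> B)\<^sup>\<top> \<star> X \<ominus>\<^sub>t (tuminus lamK \<star> X\<^sup>\<top> \<star> K\<^sup>\<top> \<star> K \<star> X \<oplus>\<^sub>t B\<^sup>\<top> \<star> B) = lamI"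
  proof -
    have l: "tuminus lamK \<in> tensor_space 1 1 p" by (rule tuminus_space[OF lamK])
    have "tuminus lamK \<star> X\<^sup>\<top> \<star> K\<^sup>\<top> \<star> K \<star> X = tuminus lamK \<star> c"
      by (simp only: c_def g_def tprod_assoc[OF p l XT KT] tprod_assoc[OF p l ps[OF XT KT] K]
          tprod_assoc[OF p l ps[OF XT ps[OF KT K]] X] tprod_assoc[OF p XT KT K] tprod_assoc[OF p XT ps[OF KT K] X]
          tprod_assoc[OF p KT K X])
    also have "\<dots> = (- 1) \<cdot>\<^sub>t (\<mu> \<cdot>\<^sub>t (c \<star> W))"
      by (simp only: tuminus_eq_tsmult lamK_W tprod_tsmult_left[OF p tsmult_space[OF W] c] tprod_tsmult_left[OF p W c]
          tube_commute[OF p c W])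
    moreover have "(A\<^sup>\<top> \<star> B)\<^sup>\<top> \<star> X = B\<^sup>\<top> \<star> (A \<star> X)"
      by (simp only: ttranspose_tprod[OF p AT B] ttranspose_ttranspose[OF A] tprod_assoc[OF p BT A X])
    moreover have "B\<^sup>\<top> \<star> (A \<star> X) = B\<^sup>\<top> \<star> B \<ominus>\<^sub>t B\<^sup>\<top> \<star> R \<star> W"
      unfolding AX_eq tminus_eq_tadd[OF B RW] tminus_eq_tadd[OF BTB BRW]
      by (simp only: tprod_tadd_right[OF p BT B tsmult_space[OF RW]] tprod_tsmult_right[OF p BT RW] tprod_assoc[OF p BT R W])
    moreover have "B\<^sup>\<top> \<star> R \<star> W = \<mu> \<cdot>\<^sub>t (c \<star> W) \<oplus>\<^sub>t Q \<star> W"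
      unfolding BTR by (simp only: tprod_tadd_left[OF p tsmult_space[OF c] Q W] tprod_tsmult_left[OF p c W])
    \<comment> \<open>The terms with \<open>B\<^sup>\<top> \<star> B\<close> and with
      \<open>c \<star> W\<close> cancel, leaving the negative of \<open>Q \<star> W\<close>.\<close>
    ultimately show ?thesis
      unfolding lamI_QW by (intro tensor_eqI[where m = 1 and n = 1 and p = p]) (simp_all add: mem ix1 del: One_nat_def)
  qed
qed

text \<open>Multiplying \<open>bcirc\<close> by \<open>unfold\<close> unfolds a T-product, so the
  two block rows are the unfolded identities of \<open>trtls_stationarity_rows\<close>, once
  \<open>tkron_tid\<close> has evaluated the Kronecker products.\<close>

theorem theorem3p6:
  fixes m n p q :: nat
    and A B K At Bt X R lamI lamK :: tensor
    and \<delta> \<mu> :: real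
    and M N P \<Gamma> \<Lambda>\<^sub>1 \<Lambda>\<^sub>2 \<Lambda> v :: "real mat"
  assumes dims: "0 < m" "0 < n" "0 < p" "0 < q"
    and A: "A \<in> tensor_space m n p"
    and B: "B \<in> tensor_space m 1 p"
    and K: "K \<in> tensor_space q n p"
    and solution: "trtls_solution m n p A B K \<delta> At Bt X"
    and active: "tnorm (K \<star> X) = \<delta>"
    and multiplier: "trtls_multiplier A B K \<delta> At X \<mu>"
  defines "R \<equiv> B \<ominus>\<^sub>t At \<star> X"
    and "lamI \<equiv> \<mu> \<cdot>\<^sub>t (X\<^sup>\<top> \<star> K\<^sup>\<top> \<star> K \<star> X) \<ominus>\<^sub>t R\<^sup>\<top> \<star> R \<star> X\<^sup>\<top> \<star> X \<ominus>\<^sub>t R\<^sup>\<top> \<star> B"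
    and "lamK \<equiv> \<mu> \<cdot>\<^sub>t (tid 1 p \<oplus>\<^sub>t X\<^sup>\<top> \<star> X)"
    and "M \<equiv> bcirc (A\<^sup>\<top> \<star> A \<oplus>\<^sub>t K\<^sup>\<top> \<star> K \<star> (lamK \<otimes>\<^sub>t tid n p))"
    and "N \<equiv> bcirc (A\<^sup>\<top> \<star> B)"
    and "P \<equiv> bcirc (tuminus lamK \<star> X\<^sup>\<top> \<star> K\<^sup>\<top> \<star> K \<star> X \<oplus>\<^sub>t B\<^sup>\<top> \<star> B)"
    and "\<Lambda>\<^sub>1 \<equiv> bcirc (lamI \<otimes>\<^sub>t tid n p)"
    and "\<Lambda>\<^sub>2 \<equiv> bcirc lamI"
    and "\<Gamma> \<equiv> four_block_mat M N (transpose_mat N) P"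
    and "\<Lambda> \<equiv> four_block_mat \<Lambda>\<^sub>1 (0\<^sub>m (n * p) p) (0\<^sub>m p (n * p)) \<Lambda>\<^sub>2"
    and "v \<equiv> unfold X @\<^sub>r (- unfold (tid 1 p))"
  shows "\<Gamma> * v = - \<Lambda> * v"
proof -
  have At: "At \<in> tensor_space m n p" and X: "X \<in> tensor_space n 1 p"
    using solution by (auto simp: trtls_solution_def trtls_feasible_def)
  note p = dims(3)
  note rows = trtls_stationarity_rows[OF p A B K At X multiplier, folded R_def, folded lamI_def lamK_def]
  note lamI = rows(3) and lamK = rows(4)
  note AT = ttranspose_space[OF A] and BT = ttranspose_space[OF B] and KT = ttranspose_space[OF K]
    and XT = ttranspose_space[OF X] and one = tid_space[of 1 p] and ps = tprod_space[OF p]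
  note DK = tube_diag_space[OF tensor_spaceD(1)[OF lamK], of n]
    and DI = tube_diag_space[OF tensor_spaceD(1)[OF lamI], of n]
  define M' where "M' = A\<^sup>\<top> \<star> A \<oplus>\<^sub>t K\<^sup>\<top> \<star> K \<star> tube_diag n lamK"
  define P' where "P' = tuminus lamK \<star> X\<^sup>\<top> \<star> K\<^sup>\<top> \<star> K \<star> X \<oplus>\<^sub>t B\<^sup>\<top> \<star> B"
  have M': "M' \<in> tensor_space n n p"
    unfolding M'_def by (rule tadd_space[OF ps[OF AT A] ps[OF ps[OF KT K] DK]])
  have P': "P' \<in> tensor_space 1 1 p"
    unfolding P'_def by (rule tadd_space[OF ps[OF ps[OF ps[OF ps[OF tuminus_space[OF lamK] XT] KT] K] X] ps[OF BT B]])
  note N' = ps[OF AT B]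
  note NT = ttranspose_space[OF N']
  define x where "x = unfold X"
  define u where "u = unfold (tid 1 p)"
  have x: "x \<in> carrier_mat (n * p) 1" and u: "u \<in> carrier_mat p 1"
    using unfold_carrier[OF X p] unfold_carrier[OF one p] by (simp_all add: x_def u_def)
  have M: "M = bcirc M'" and L1: "\<Lambda>\<^sub>1 = bcirc (tube_diag n lamI)" and P: "P = bcirc P'"
    unfolding M_def \<Lambda>\<^sub>1_def P_def M'_def P'_def tkron_tid[OF lamK p] tkron_tid[OF lamI p] by (rule refl)+
  have carr: "M \<in> carrier_mat (n * p) (n * p)" "N \<in> carrier_mat (n * p) p"
    "transpose_mat N \<in> carrier_mat p (n * p)" "P \<in> carrier_mat p p"
    "\<Lambda>\<^sub>1 \<in> carrier_mat (n * p) (n * p)" "\<Lambda>\<^sub>2 \<in> carrier_mat p p"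
    using bcirc_carrier[OF M' p] bcirc_carrier[OF N' p] bcirc_carrier[OF P' p] bcirc_carrier[OF DI p]
      bcirc_carrier[OF lamI p]
    by (simp_all add: M P L1 N_def \<Lambda>\<^sub>2_def)
  \<comment> \<open>Since \<open>u\<close> unfolds the identity tube, multiplying the block
    circulant matrix of a tensor with one column by \<open>u\<close> returns the unfolding of that
    tensor.\<close>
  have Mx: "M * x = unfold (M' \<star> X)" and Nu: "N * u = unfold (A\<^sup>\<top> \<star> B)" and NTx: "transpose_mat N * x = unfold ((A\<^sup>\<top> \<star> B)\<^sup>\<top> \<star> X)"
    and Pu: "P * u = unfold P'" and L1x: "\<Lambda>\<^sub>1 * x = unfold (tube_diag n lamI \<star> X)" and L2u: "\<Lambda>\<^sub>2 * u = unfold lamI"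
    using unfold_tprod[OF p M' X] unfold_tprod[OF p N' one] unfold_tprod[OF p NT X] unfold_tprod[OF p P' one]
      unfold_tprod[OF p DI X] unfold_tprod[OF p lamI one]
    by (simp_all add: M P L1 N_def \<Lambda>\<^sub>2_def x_def u_def bcirc_ttranspose[OF p N'] tprod_tid_right[OF p N']
        tprod_tid_right[OF p P'] tprod_tid_right[OF p lamI] del: One_nat_def)
  have "\<Gamma> * v = (M * x + N * - u) @\<^sub>r (transpose_mat N * x + P * - u)"
    unfolding \<Gamma>_def v_def x_def[symmetric] u_def[symmetric]
    by (rule four_block_mat_mult_append_rows[OF carr(1-4) x]) (use u in simp)
  also have "M * x + N * - u = - (\<Lambda>\<^sub>1 * x)"
  proof -
    have "M * x + N * - u = M * x - N * u"
      using carr x u by (simp add: add_uminus_minus_mat[of _ "n * p" 1])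
    also have "\<dots> = unfold (M' \<star> X \<ominus>\<^sub>t A\<^sup>\<top> \<star> B)"
      unfolding Mx Nu by (rule unfold_tminus[OF ps[OF M' X] N' p, symmetric])
    also have "\<dots> = - (\<Lambda>\<^sub>1 * x)"
      unfolding L1x M'_def rows(1) by (rule unfold_tuminus[OF ps[OF DI X] p])
    finally show ?thesis .
  qed
  also have "transpose_mat N * x + P * - u = \<Lambda>\<^sub>2 * u"
  proof -
    have "transpose_mat N * x + P * - u = transpose_mat N * x - P * u"
      using carr x u by (simp add: add_uminus_minus_mat[of _ p 1])
    also have "\<dots> = unfold ((A\<^sup>\<top> \<star> B)\<^sup>\<top> \<star> X \<ominus>\<^sub>t P')"
      unfolding NTx Pu by (rule unfold_tminus[OF ps[OF NT X] P' p, symmetric])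
    also have "\<dots> = \<Lambda>\<^sub>2 * u"
      unfolding L2u P'_def rows(2) ..
    finally show ?thesis .
  qed
  \<comment> \<open>The lower part of \<open>v\<close> is \<open>- u\<close>, so the sign in front
    of \<open>\<Lambda>\<close> cancels in the lower block only.\<close>
  also have "- (\<Lambda>\<^sub>1 * x) @\<^sub>r (\<Lambda>\<^sub>2 * u) = - (\<Lambda> * v)"
  proof -
    have "\<Lambda> * v = (\<Lambda>\<^sub>1 * x + 0\<^sub>m (n * p) p * - u) @\<^sub>r (0\<^sub>m p (n * p) * x + \<Lambda>\<^sub>2 * - u)"
      unfolding \<Lambda>_def v_def x_def[symmetric] u_def[symmetric]
      by (rule four_block_mat_mult_append_rows[OF carr(5) _ _ carr(6) x]) (use u in simp_all)
    also have "\<dots> = (\<Lambda>\<^sub>1 * x) @\<^sub>r (- (\<Lambda>\<^sub>2 * u))"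
    proof -
      have "- 0\<^sub>m a b = (0\<^sub>m a b :: real mat)" for a b by (intro eq_matI) auto
      then show ?thesis using carr x u by simp
    qed
    finally show ?thesis
      using carr x u by (simp add: uminus_append_rows[of _ "n * p" 1 _ p])
  qed
  also have "- (\<Lambda> * v) = - \<Lambda> * v"
  proof -
    have "\<Lambda> \<in> carrier_mat (n * p + p) (n * p + p)"
      unfolding \<Lambda>_def by (rule four_block_carrier_mat[OF carr(5,6)])
    moreover have "v \<in> carrier_mat (n * p + p) 1"
      unfolding v_def x_def[symmetric] u_def[symmetric] using x u by auto
    ultimately show ?thesis by simp
  qed
  finally show ?thesis .
qed

end
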